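(* Let $\mathbb V$ be a Schubert representation of $\widehat H_n$ with generic Schubert classes $\{\mathcal Y_w\}$ and equivariant parameters $t_1,\dots,t_n$, and let $f\in\mathcal A_\hbar[x_1,\dots,x_n]$ be symmetric in $x_1,\dots,x_k$ and symmetric in $x_{k+1},\dots,x_n$. (i) For each $\mu\subseteq(n-k)^k$ there are $P_{\lambda,\mu}\in\mathcal A_\hbar[x_1,\dots,x_n]$ with $$\overline T_\mu f=\sum_{\lambda\subseteq(n-k)^k}P_{\lambda,\mu}(x_1,\dots,x_n)\,\overline T_\lambda.$$ (ii) With these $P_{\lambda,\mu}$, for each $\lambda\subseteq(n-k)^k$, $$f\cdot\mathcal Y_\lambda=\sum_{\mu\subseteq(n-k)^k}P_{\lambda,\mu}(t_1,\dots,t_n)\,\mathcal Y_\mu.$$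
   Context: $\mathcal A_\hbar=\mathbb Q[p,q,\hbar]$; $\widehat H_n$ is the $\mathcal A_\hbar$-algebra generated by $T_1,\dots,T_{n-1},x_1,\dots,x_n$ with relations $(T_i+p)(T_i-q)=0$, $T_iT_j=T_jT_i$ ($|i-j|>1$), $T_iT_{i+1}T_i=T_{i+1}T_iT_{i+1}$, $x_ix_j=x_jx_i$, $T_ix_j=x_jT_i$ ($j\ne i,i+1$), $T_ix_i=x_{i+1}T_i+(\hbar-(p-q)x_i)$, $T_ix_{i+1}=x_iT_i-(\hbar-(p-q)x_i)$. $T_w,\overline T_w$ are defined via reduced words, with $\overline T_i=T_i+p-q$. Schubert representation: field $\mathbb F$, $t_1,\dots,t_n\in\mathbb F$, ring map $\mathcal A_\hbar\to\mathbb F$, $\mathbb F$-space $\mathbb V$ with $\widehat H_n$-action (scalars of $\mathcal A_\hbar$ via $\mathbb F$), basis $\mathcal Y_w=T_{w^{-1}w_0}\cdot\mathcal Y_{w_0}$, and $\mathbb F$-linear $\operatorname{ev}$ with $\operatorname{ev}(\mathcal Y_w)\ne0\iff w=\mathrm{id}$ and $\operatorname{ev}(x_i\mathcal Y_w)=t_i\operatorname{ev}(\mathcal Y_w)$. Partitions $\lambda\subseteq(n-k)^k$: $n-k\ge\lambda_1\ge\dots\ge\lambda_k\ge0$; $w_\lambda\in S_n$ with $w_\lambda(k+1-i)=\lambda_i+k+1-i$ ($1\le i\le k$), increasing on $\{k+1,\dots,n\}$; every $w\in S_n$ factors uniquely as $w=w_\lambda v$ with $v\in S_k\times S_{n-k}$,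 and we write $\operatorname{Gr}(w)=\lambda$. Quantum numbers $[m]=(p^m-q^m)/(p-q)$, $[m]!=[m][m-1]\cdots[1]$, $[0]!=1$; $d=\binom k2+\binom{n-k}2$. Define $\Sigma^n_k=\frac1{[k]![n-k]!}\sum_{v\in S_k\times S_{n-k}}q^{d-\ell(v)}\overline T_v$ (scalars extended so that $[k]![n-k]!$ is invertible), $\overline T_\lambda=\overline T_{w_\lambda}\Sigma^n_k$, and $\mathcal Y_\lambda=\sum_{v\in S_k\times S_{n-k}}p^{\ell(v)}\mathcal Y_{w_\lambda v}$. $P(t_1,\dots,t_n)$ means the image in $\mathbb F$ under $x_i\mapsto t_i$. *)

theory Defs
  imports Complex_Main "HOL-Library.Poly_Mapping" "HOL-Combinatorics.Permutations" "HOL-Combinatorics.Transposition"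
begin

text \<open>Generators: Gp, Gq, Gh are the scalars p, q, hbar of A_hbar = Q[p,q,hbar];
  GT i is T_i (1 <= i <= n-1), GX i is x_i (1 <= i <= n); Gc is the adjoined inverse of
  [k]![n-k]! (used only for the localized algebra in which Sigma^n_k lives).\<close>
datatype gen = Gp | Gq | Gh | GT nat | GX nat | Gc

text \<open>Free associative Q-algebra on the generators: finitely supported functions on words.\<close>
type_synonym fa = "gen list \<Rightarrow>\<^sub>0 rat"

definition fmul :: "fa \<Rightarrow> fa \<Rightarrow> fa" where
  "fmul a b = (\<Sum>u\<in>Poly_Mapping.keys a. \<Sum>w\<in>Poly_Mapping.keys b. Poly_Mapping.single (u @ w) (Poly_Mapping.lookup a u * Poly_Mapping.lookup b w))"

definition fconst :: "rat \<Rightarrow> fa" where "fconst r = Poly_Mapping.single [] r"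
definition fone :: fa where "fone = fconst 1"
definition fgen :: "gen \<Rightarrow> fa" where "fgen g = Poly_Mapping.single [g] 1"
definition fprod :: "fa list \<Rightarrow> fa" where "fprod xs = foldr fmul xs fone"
definition fpow :: "gen \<Rightarrow> nat \<Rightarrow> fa" where "fpow g j = fprod (replicate j (fgen g))"
definition fcomm :: "fa \<Rightarrow> fa \<Rightarrow> fa" where "fcomm a b = fmul a b - fmul b a"

inductive_set fideal :: "fa set \<Rightarrow> fa set" for R :: "fa set" where
  gen: "r \<in> R \<Longrightarrow> fmul (fmul a r) b \<in> fideal R"
| zero: "0 \<in> fideal R"
| add: "a \<in> fideal R \<Longrightarrow> b \<in> fideal R \<Longrightarrow> a + b \<in> fideal R"

definition heq :: "fa set \<Rightarrow> fa \<Rightarrow> fa \<Rightarrow> bool" where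
  "heq R a b \<longleftrightarrow> a - b \<in> fideal R"

definition scal_gen :: "gen \<Rightarrow> bool" where
  "scal_gen g \<longleftrightarrow> g = Gp \<or> g = Gq \<or> g = Gh"

text \<open>Relators of \<open>\<widehat>H_n\<close> over A_hbar (as a Q-algebra with central p,q,hbar).
  Generators out of range are killed, so the quotient is exactly \<open>\<widehat>H_n\<close>.\<close>
definition hrel :: "nat \<Rightarrow> fa set" where
  "hrel n =
     {fcomm (fgen s) (fgen g) | s g. scal_gen s}
   \<union> {fgen (GT i) | i. i = 0 \<or> n \<le> i}
   \<union> {fgen (GX i) | i. i = 0 \<or> n < i}
   \<union> {fgen Gc}
   \<union> {fmul (fgen (GT i) + fgen Gp) (fgen (GT i) - fgen Gq) | i. 1 \<le> i \<and> i < n}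
   \<union> {fcomm (fgen (GT i)) (fgen (GT j)) | i j. 1 \<le> i \<and> i < n \<and> 1 \<le> j \<and> j < n \<and> Suc i < j}
   \<union> {fprod [fgen (GT i), fgen (GT (Suc i)), fgen (GT i)]
        - fprod [fgen (GT (Suc i)), fgen (GT i), fgen (GT (Suc i))] | i. 1 \<le> i \<and> Suc i < n}
   \<union> {fcomm (fgen (GX i)) (fgen (GX j)) | i j. 1 \<le> i \<and> i \<le> n \<and> 1 \<le> j \<and> j \<le> n}
   \<union> {fcomm (fgen (GT i)) (fgen (GX j)) | i j. 1 \<le> i \<and> i < n \<and> 1 \<le> j \<and> j \<le> n \<and> j \<noteq> i \<and> j \<noteq> Suc i}
   \<union> {fmul (fgen (GT i)) (fgen (GX i))
        - (fmul (fgen (GX (Suc i))) (fgen (GT i))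
           + (fgen Gh - fmul (fgen Gp - fgen Gq) (fgen (GX i)))) | i. 1 \<le> i \<and> i < n}
   \<union> {fmul (fgen (GT i)) (fgen (GX (Suc i)))
        - (fmul (fgen (GX i)) (fgen (GT i))
           - (fgen Gh - fmul (fgen Gp - fgen Gq) (fgen (GX i)))) | i. 1 \<le> i \<and> i < n}"

text \<open>Quantum numbers [m] = (p^m - q^m)/(p-q) = sum_{j<m} p^j q^(m-1-j), and [m]!.\<close>
definition fqnum :: "nat \<Rightarrow> fa" where
  "fqnum m = (\<Sum>j<m. fmul (fpow Gp j) (fpow Gq (m - 1 - j)))"
definition fqfact :: "nat \<Rightarrow> fa" where
  "fqfact m = fprod (map fqnum (rev [1..<Suc m]))"

text \<open>Scalar extension A_hbar[1/([k]![n-k]!)]: Gc is a central inverse of [k]![n-k]!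
  (instead of being killed).\<close>
definition hrel_loc :: "nat \<Rightarrow> nat \<Rightarrow> fa set" where
  "hrel_loc n k = (hrel n - {fgen Gc})
     \<union> {fcomm (fgen Gc) (fgen g) | g. True}
     \<union> {fmul (fgen Gc) (fmul (fqfact k) (fqfact (n - k))) - fone}"

definition Sn :: "nat \<Rightarrow> (nat \<Rightarrow> nat) set" where
  "Sn n = {w. w permutes {1..n}}"

definition young :: "nat \<Rightarrow> nat \<Rightarrow> (nat \<Rightarrow> nat) set" where
  "young n k = {v. v permutes {1..n} \<and> v ` {1..k} = {1..k}}"

definition plen :: "nat \<Rightarrow> (nat \<Rightarrow> nat) \<Rightarrow> nat" where
  "plen n w = card {(i, j). 1 \<le> i \<and> i < j \<and> j \<le> n \<and> w j < w i}"

definition w0 :: "nat \<Rightarrow> nat \<Rightarrow> nat" where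
  "w0 n i = (if 1 \<le> i \<and> i \<le> n then n + 1 - i else i)"

definition sprod :: "nat list \<Rightarrow> nat \<Rightarrow> nat" where
  "sprod ws = foldr (\<lambda>i acc. transpose i (Suc i) \<circ> acc) ws id"

definition red_word :: "nat \<Rightarrow> (nat \<Rightarrow> nat) \<Rightarrow> nat list \<Rightarrow> bool" where
  "red_word n w ws \<longleftrightarrow> (\<forall>i\<in>set ws. 1 \<le> i \<and> i < n) \<and> sprod ws = w \<and> length ws = plen n w"

definition rword :: "nat \<Rightarrow> (nat \<Rightarrow> nat) \<Rightarrow> nat list" where
  "rword n w = (SOME ws. red_word n w ws)"

definition Tw :: "nat \<Rightarrow> (nat \<Rightarrow> nat) \<Rightarrow> fa" where
  "Tw n w = fprod (map (\<lambda>i. fgen (GT i)) (rword n w))"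

definition Tbar_i :: "nat \<Rightarrow> fa" where
  "Tbar_i i = fgen (GT i) + fgen Gp - fgen Gq"

definition Tbarw :: "nat \<Rightarrow> (nat \<Rightarrow> nat) \<Rightarrow> fa" where
  "Tbarw n w = fprod (map Tbar_i (rword n w))"

text \<open>lam ! (i-1) is lambda_i.\<close>
definition parts :: "nat \<Rightarrow> nat \<Rightarrow> nat list set" where
  "parts n k = {lam. length lam = k \<and> (\<forall>i<k. lam ! i \<le> n - k) \<and> sorted (rev lam)}"

definition wlam :: "nat \<Rightarrow> nat \<Rightarrow> nat list \<Rightarrow> nat \<Rightarrow> nat" where
  "wlam n k lam = (THE w. w permutes {1..n}
      \<and> (\<forall>i\<in>{1..k}. w (k + 1 - i) = lam ! (i - 1) + k + 1 - i)
      \<and> strict_mono_on {k+1..n} w)"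

definition dkn :: "nat \<Rightarrow> nat \<Rightarrow> nat" where
  "dkn n k = (k choose 2) + ((n - k) choose 2)"

definition Sigma_nk :: "nat \<Rightarrow> nat \<Rightarrow> fa" where
  "Sigma_nk n k = fmul (fgen Gc) (\<Sum>v\<in>young n k. fmul (fpow Gq (dkn n k - plen n v)) (Tbarw n v))"

definition Tbar_lam :: "nat \<Rightarrow> nat \<Rightarrow> nat list \<Rightarrow> fa" where
  "Tbar_lam n k lam = fmul (Tbarw n (wlam n k lam)) (Sigma_nk n k)"

text \<open>Commutative polynomials with rational coefficients in the variables Gp, Gq, Gh, GX i.\<close>
type_synonym mpoly = "(gen \<Rightarrow>\<^sub>0 nat) \<Rightarrow>\<^sub>0 rat"

definition is_Ahx :: "nat \<Rightarrow> mpoly \<Rightarrow> bool" where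
  "is_Ahx n f \<longleftrightarrow> (\<forall>m\<in>Poly_Mapping.keys f. \<forall>v\<in>Poly_Mapping.keys m. scal_gen v \<or> (\<exists>i. v = GX i \<and> 1 \<le> i \<and> i \<le> n))"

definition gen_rename :: "(nat \<Rightarrow> nat) \<Rightarrow> gen \<Rightarrow> gen" where
  "gen_rename s g = (case g of GX i \<Rightarrow> GX (s i) | _ \<Rightarrow> g)"

definition mp_rename :: "(nat \<Rightarrow> nat) \<Rightarrow> mpoly \<Rightarrow> mpoly" where
  "mp_rename s f = (\<Sum>m\<in>Poly_Mapping.keys f. Poly_Mapping.single
       (\<Sum>v\<in>Poly_Mapping.keys m. Poly_Mapping.single (gen_rename s v) (Poly_Mapping.lookup m v)) (Poly_Mapping.lookup f m))"

definition block_symmetric :: "nat \<Rightarrow> nat \<Rightarrow> mpoly \<Rightarrow> bool" where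
  "block_symmetric n k f \<longleftrightarrow> (\<forall>s\<in>young n k. mp_rename s f = f)"

definition mono_word :: "(gen \<Rightarrow>\<^sub>0 nat) \<Rightarrow> gen list" where
  "mono_word m = concat (map (\<lambda>v. replicate (Poly_Mapping.lookup m v) v) (SOME xs. distinct xs \<and> set xs = Poly_Mapping.keys m))"

definition mp_to_fa :: "mpoly \<Rightarrow> fa" where
  "mp_to_fa f = (\<Sum>m\<in>Poly_Mapping.keys f. Poly_Mapping.single (mono_word m) (Poly_Mapping.lookup f m))"

definition mp_eval :: "(gen \<Rightarrow> 'f::field_char_0) \<Rightarrow> mpoly \<Rightarrow> 'f" where
  "mp_eval val f = (\<Sum>m\<in>Poly_Mapping.keys f. of_rat (Poly_Mapping.lookup f m) * (\<Prod>v\<in>Poly_Mapping.keys m. val v ^ Poly_Mapping.lookup m v))"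

definition gen_act :: "nat \<Rightarrow> ('f \<Rightarrow> 'v \<Rightarrow> 'v) \<Rightarrow> 'f \<Rightarrow> 'f \<Rightarrow> 'f \<Rightarrow>
    (nat \<Rightarrow> 'v \<Rightarrow> 'v) \<Rightarrow> (nat \<Rightarrow> 'v \<Rightarrow> 'v) \<Rightarrow> gen \<Rightarrow> 'v \<Rightarrow> ('v::ab_group_add)" where
  "gen_act n scale pF qF hF Top Xop g = (case g of
      Gp \<Rightarrow> scale pF | Gq \<Rightarrow> scale qF | Gh \<Rightarrow> scale hF
    | GT i \<Rightarrow> (if 1 \<le> i \<and> i < n then Top i else (\<lambda>_. 0))
    | GX i \<Rightarrow> (if 1 \<le> i \<and> i \<le> n then Xop i else (\<lambda>_. 0))
    | Gc \<Rightarrow> (\<lambda>_. 0))"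

definition vact :: "nat \<Rightarrow> ('f::field_char_0 \<Rightarrow> 'v \<Rightarrow> 'v) \<Rightarrow> 'f \<Rightarrow> 'f \<Rightarrow> 'f \<Rightarrow>
    (nat \<Rightarrow> 'v \<Rightarrow> 'v) \<Rightarrow> (nat \<Rightarrow> 'v \<Rightarrow> 'v) \<Rightarrow> fa \<Rightarrow> 'v \<Rightarrow> ('v::ab_group_add)" where
  "vact n scale pF qF hF Top Xop a x = (\<Sum>u\<in>Poly_Mapping.keys a.
      scale (of_rat (Poly_Mapping.lookup a u)) (foldr (\<lambda>g h. gen_act n scale pF qF hF Top Xop g \<circ> h) u id x))"

text \<open>V (type 'v) is an F-vector space (F of type 'f, char 0 since it receives a ring map from
  A_hbar containing Q; the map sends p,q,hbar to pF,qF,hF) with an F-linear action of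
  \<open>\<widehat>H_n\<close> (Top i = T_i, Xop i = x_i), basis Y_w, w in S_n, with
  Y_w = T_{w^-1 w0} Y_{w0}, and an F-linear ev as in the definition.\<close>
definition schubert_rep :: "nat \<Rightarrow> ('f::field_char_0 \<Rightarrow> 'v \<Rightarrow> ('v::ab_group_add)) \<Rightarrow> 'f \<Rightarrow> 'f \<Rightarrow> 'f
    \<Rightarrow> (nat \<Rightarrow> 'f) \<Rightarrow> (nat \<Rightarrow> 'v \<Rightarrow> 'v) \<Rightarrow> (nat \<Rightarrow> 'v \<Rightarrow> 'v)
    \<Rightarrow> ((nat \<Rightarrow> nat) \<Rightarrow> 'v) \<Rightarrow> ('v \<Rightarrow> 'f) \<Rightarrow> bool" where
  "schubert_rep n scale pF qF hF t Top Xop Y ev \<longleftrightarrow>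
     vector_space scale
   \<and> (\<forall>i. 1 \<le> i \<and> i < n \<longrightarrow> Vector_Spaces.linear scale scale (Top i))
   \<and> (\<forall>i. 1 \<le> i \<and> i \<le> n \<longrightarrow> Vector_Spaces.linear scale scale (Xop i))
   \<and> (\<forall>r\<in>hrel n. \<forall>x. vact n scale pF qF hF Top Xop r x = 0)
   \<and> inj_on Y (Sn n)
   \<and> \<not> module.dependent scale (Y ` Sn n)
   \<and> module.span scale (Y ` Sn n) = UNIV
   \<and> (\<forall>w\<in>Sn n. Y w = vact n scale pF qF hF Top Xop (Tw n (inv w \<circ> w0 n)) (Y (w0 n)))
   \<and> Vector_Spaces.linear scale (*) ev
   \<and> (\<forall>w\<in>Sn n. ev (Y w) \<noteq> 0 \<longleftrightarrow> w = id)
   \<and> (\<forall>w\<in>Sn n. \<forall>i. 1 \<le> i \<and> i \<le> n \<longrightarrow> ev (Xop i (Y w)) = t i * ev (Y w))"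

definition Y_lam :: "nat \<Rightarrow> nat \<Rightarrow> ('f::field_char_0 \<Rightarrow> 'v \<Rightarrow> ('v::ab_group_add)) \<Rightarrow> 'f
    \<Rightarrow> ((nat \<Rightarrow> nat) \<Rightarrow> 'v) \<Rightarrow> nat list \<Rightarrow> 'v" where
  "Y_lam n k scale pF Y lam = (\<Sum>v\<in>young n k. scale (pF ^ plen n v) (Y (wlam n k lam \<circ> v)))"

definition eval_val :: "'f \<Rightarrow> 'f \<Rightarrow> 'f \<Rightarrow> (nat \<Rightarrow> 'f) \<Rightarrow> gen \<Rightarrow> ('f::field_char_0)" where
  "eval_val pF qF hF t g = (case g of Gp \<Rightarrow> pF | Gq \<Rightarrow> qF | Gh \<Rightarrow> hF | GX i \<Rightarrow> t i | _ \<Rightarrow> 0)"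

end

theory Submission
  imports Defs
begin

text \<open>Write \<open>\<T>\<^sub>w\<close> for \<open>Tbarw n w\<close>. Pushing \<open>\<T>\<^sub>w\<close> past a polynomial letter by letter gives
  \<open>\<T>\<^sub>w f = \<Sum>\<^sub>u c\<^sub>u \<T>\<^sub>u\<close> with polynomial coefficients \<open>c\<^sub>u\<close>. Call \<open>z\<close> in a module an eigenvector
  of the Young subgroup if \<open>\<T>\<^sub>v z = p\<^bsup>\<ell>(v)\<^esup> z\<close> for all \<open>v\<close> in it. Factoring \<open>u = w\<^sub>\<lambda> v\<close> in the
  expansion for \<open>w = w\<^sub>\<mu>\<close> yields \<open>\<T>\<^sub>w f z = \<Sum>\<^sub>\<lambda> P\<^bsub>\<lambda>,\<mu>\<^esub> \<T>\<^bsub>w\<^sub>\<lambda>\<^esub> z\<close> for every eigenvector \<open>z\<close>, where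
  \<open>P\<^bsub>\<lambda>,\<mu>\<^esub> = \<Sum>\<^sub>v p\<^bsup>\<ell>(v)\<^esup> c\<^bsub>w\<^sub>\<lambda>v\<^esub>\<close>. Both \<open>\<Sigma>\<close>, in the regular module, and \<open>Y\<^sub>\<lambda>\<close> are eigenvectors,
  because they are sums of vectors in the image of \<open>T\<^sub>i + p\<close> for every \<open>i \<noteq> k\<close>.

  For (i), take \<open>z = \<Sigma>\<close>, which commutes with the block-symmetric \<open>f\<close>. For (ii), take \<open>z = Y\<^sub>\<lambda>\<close> and
  use that \<open>ev(\<T>\<^sub>w Y\<^sub>u) = \<delta>\<^bsub>w,u\<^esub> ev(Y\<^sub>i\<^sub>d)\<close>, so that an eigenvector \<open>y\<close> is determined by the numbers
  \<open>ev(\<T>\<^bsub>w\<^sub>\<mu>\<^esub> y)\<close>.\<close>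

subsection \<open>Length and inversions\<close>

abbreviation adj :: "nat \<Rightarrow> nat \<Rightarrow> nat" where
  "adj i \<equiv> transpose i (Suc i)"

lemma comp_adj_adj [simp]: "w \<circ> adj i \<circ> adj i = w"
  by (simp add: fun_eq_iff)

lemma adj_adj_comp [simp]: "adj i \<circ> (adj i \<circ> w) = w"
  by (simp add: fun_eq_iff)

lemma adj_permutes: "1 \<le> i \<Longrightarrow> i < n \<Longrightarrow> adj i permutes {1..n}"
  by (rule permutes_swap_id) auto

definition inversions :: "nat \<Rightarrow> (nat \<Rightarrow> nat) \<Rightarrow> (nat \<times> nat) set" where
  "inversions n w = {(i, j). 1 \<le> i \<and> i < j \<and> j \<le> n \<and> w j < w i}"

lemma plen_eq_card_inversions: "plen n w = card (inversions n w)"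
  by (simp add: plen_def inversions_def)

lemma finite_inversions: "finite (inversions n w)"
  by (rule finite_subset[of _ "{1..n} \<times> {1..n}"]) (auto simp: inversions_def)

lemma plen_id [simp]: "plen n id = 0"
proof -
  have "inversions n id = {}" by (auto simp: inversions_def)
  then show ?thesis by (simp add: plen_eq_card_inversions)
qed

lemma inversions_comp_adj:
  assumes "(a, b) \<in> inversions n (w \<circ> adj i)" "(a, b) \<noteq> (i, Suc i)" "1 \<le> i" "i < n"
  shows "(adj i a, adj i b) \<in> inversions n w - {(i, Suc i)}"
proof -
  have "adj i a \<in> {1..n}" "adj i b \<in> {1..n}"
    using assms permutes_in_image[OF adj_permutes[OF assms(3,4)]] by (auto simp: inversions_def)
  moreover have "adj i a < adj i b" "(adj i a, adj i b) \<noteq> (i, Suc i)"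
    using assms(1,2) by (auto simp: inversions_def transpose_def)
  ultimately show ?thesis using assms(1) by (auto simp: inversions_def)
qed

lemma plen_comp_adj_ascent:
  assumes "1 \<le> i" "i < n" "w i < w (Suc i)"
  shows "plen n (w \<circ> adj i) = Suc (plen n w)"
proof -
  let ?swap = "map_prod (adj i) (adj i)" and ?J = "inversions n (w \<circ> adj i)"
  have new: "(i, Suc i) \<in> ?J" using assms by (simp add: inversions_def)
  have "bij_betw ?swap (?J - {(i, Suc i)}) (inversions n w)"
  proof (rule bij_betw_byWitness[where f' = ?swap])
    show "?swap ` (?J - {(i, Suc i)}) \<subseteq> inversions n w"
      using inversions_comp_adj[of _ _ n w i] assms by auto
    have "(i, Suc i) \<notin> inversions n w" using assms(3) by (simp add: inversions_def)
    then have "(adj i a, adj i b) \<in> ?J - {(i, Suc i)}" if "(a, b) \<in> inversions n w" for a b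
      using inversions_comp_adj[of a b n "w \<circ> adj i" i] that assms(1,2) by auto
    then show "?swap ` inversions n w \<subseteq> ?J - {(i, Suc i)}" by auto
  qed auto
  then have "card (?J - {(i, Suc i)}) = card (inversions n w)" by (rule bij_betw_same_card)
  then show ?thesis
    using card_Suc_Diff1[OF finite_inversions new] by (simp add: plen_eq_card_inversions)
qed

lemma plen_comp_adj_descent:
  assumes "1 \<le> i" "i < n" "w (Suc i) < w i"
  shows "plen n w = Suc (plen n (w \<circ> adj i))"
  using plen_comp_adj_ascent[of i n "w \<circ> adj i"] assms by simp

lemma plen_inv:
  assumes "w permutes {1..n}"
  shows "plen n (inv w) = plen n w"
proof -
  have in_range: "1 \<le> u a \<longleftrightarrow> 1 \<le> a" "u a \<le> n \<longleftrightarrow> a \<le> n" if "u permutes {1..n}" for u a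
    using permutes_in_image[OF that, of a] permutes_not_in[OF that, of a]
    by (cases "a \<in> {1..n}"; auto)+
  note in_range = in_range[OF assms] in_range[OF permutes_inv[OF assms]]
  note inverses = permutes_inverses[OF assms]
  have "bij_betw (\<lambda>(a, b). (w b, w a)) (inversions n w) (inversions n (inv w))"
    by (rule bij_betw_byWitness[where f' = "\<lambda>(a, b). (inv w b, inv w a)"])
      (auto simp: inversions_def inverses in_range simp del: One_nat_def)
  then show ?thesis
    by (simp add: plen_eq_card_inversions bij_betw_same_card)
qed

subsection \<open>Young subgroups and Grassmannian permutations\<close>

lemma Sn_eq_young: "Sn n = young n n"
  using permutes_image[where S = "{1..n}"] by (auto simp: Sn_def young_def)

lemma young_imp_Sn: "v \<in> young n k \<Longrightarrow> v \<in> Sn n"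
  by (auto simp: young_def Sn_def)

lemma finite_Sn [simp]: "finite (Sn n)"
  by (simp add: Sn_def finite_permutations)

lemma finite_young [simp]: "finite (young n k)"
  using finite_Sn by (rule finite_subset[rotated]) (auto intro: young_imp_Sn)

lemma id_in_young [simp]: "id \<in> young n k"
  by (simp add: young_def permutes_id)

lemma id_in_Sn [simp]: "id \<in> Sn n"
  by (simp add: Sn_eq_young)

lemma comp_in_young: "v \<in> young n k \<Longrightarrow> u \<in> young n k \<Longrightarrow> v \<circ> u \<in> young n k"
  unfolding young_def mem_Collect_eq image_comp[symmetric] by (metis permutes_compose)

lemma comp_in_Sn: "v \<in> Sn n \<Longrightarrow> u \<in> Sn n \<Longrightarrow> v \<circ> u \<in> Sn n"
  by (simp add: Sn_eq_young comp_in_young)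

lemma inj_Sn: "w \<in> Sn n \<Longrightarrow> inj w"
  by (auto simp: Sn_def dest: permutes_inj)

lemma bij_Sn: "w \<in> Sn n \<Longrightarrow> bij w"
  by (auto simp: Sn_def dest: permutes_bij)

lemma Sn_image: "w \<in> Sn n \<Longrightarrow> w ` {1..n} = {1..n}"
  by (auto simp: Sn_def dest: permutes_image)

lemma inv_in_young:
  assumes "v \<in> young n k"
  shows "inv v \<in> young n k"
proof -
  have perm: "v permutes {1..n}" and image: "v ` {1..k} = {1..k}"
    using assms by (auto simp: young_def)
  have "inv v ` {1..k} = inv v ` v ` {1..k}" using image by simp
  also have "\<dots> = {1..k}" using permutes_inj[OF perm] by (simp add: image_comp)
  finally show ?thesis using permutes_inv[OF perm] by (simp add: young_def)
qed

lemma inv_in_Sn: "v \<in> Sn n \<Longrightarrow> inv v \<in> Sn n"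
  by (simp add: Sn_eq_young inv_in_young)

lemma adj_in_young:
  assumes "1 \<le> i" "i < n" "i \<noteq> k"
  shows "adj i \<in> young n k"
proof -
  have "adj i ` {1..k} \<subseteq> {1..k}" using assms by (auto simp: transpose_def)
  then have "adj i ` {1..k} = {1..k}"
    by (intro card_subset_eq card_image) (auto simp: inj_on_def transpose_eq_iff)
  then show ?thesis using adj_permutes[OF assms(1,2)] by (simp add: young_def)
qed

lemma adj_in_Sn: "1 \<le> i \<Longrightarrow> i < n \<Longrightarrow> adj i \<in> Sn n"
  by (simp add: Sn_eq_young adj_in_young)

lemma comp_adj_in_young: "v \<in> young n k \<Longrightarrow> 1 \<le> i \<Longrightarrow> i < n \<Longrightarrow> i \<noteq> k \<Longrightarrow> v \<circ> adj i \<in> young n k"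
  by (intro comp_in_young adj_in_young)

lemma comp_adj_in_Sn: "w \<in> Sn n \<Longrightarrow> 1 \<le> i \<Longrightarrow> i < n \<Longrightarrow> w \<circ> adj i \<in> Sn n"
  by (intro comp_in_Sn adj_in_Sn)

lemma Sn_ascent_cases:
  assumes "w \<in> Sn n"
  obtains (ascent) "w i < w (Suc i)" | (descent) "w (Suc i) < w i"
  using inj_Sn[OF assms] by (metis inj_eq n_not_Suc_n linorder_neqE_nat)

lemma young_upper_block:
  assumes "v \<in> young n k" "k \<le> n"
  shows "v ` {k+1..n} = {k+1..n}"
proof -
  have "v \<in> Sn n" and image: "v ` {1..k} = {1..k}"
    using assms young_imp_Sn by (auto simp: young_def)
  moreover have "{k+1..n} = {1..n} - {1..k}" using assms(2) by auto
  ultimately show ?thesis by (simp add: image_set_diff inj_Sn Sn_image del: One_nat_def)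
qed

definition grassmannian :: "nat \<Rightarrow> nat \<Rightarrow> (nat \<Rightarrow> nat) set" where
  "grassmannian n k = {w \<in> Sn n. strict_mono_on {1..k} w \<and> strict_mono_on {k+1..n} w}"

lemma grassmannian_imp_Sn: "w \<in> grassmannian n k \<Longrightarrow> w \<in> Sn n"
  by (auto simp: grassmannian_def)

lemma id_in_grassmannian: "id \<in> grassmannian n k"
  by (auto simp: grassmannian_def strict_mono_on_def)

lemma grassmannianI:
  assumes "w \<in> Sn n" "k \<le> n" "\<And>i. 1 \<le> i \<Longrightarrow> i < n \<Longrightarrow> i \<noteq> k \<Longrightarrow> \<not> w (Suc i) < w i"
  shows "w \<in> grassmannian n k"
proof -
  have ascent: "w i < w (Suc i)" if "1 \<le> i" "i < n" "i \<noteq> k" for i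
    using Sn_ascent_cases[OF assms(1), of i] assms(3)[OF that] by blast
  have mono: "strict_mono_on {a..b} w"
    if N: "{a..<b} \<subseteq> {i. 1 \<le> i \<and> i < n \<and> i \<noteq> k}" (is "_ \<subseteq> ?N") for a b
  proof (rule strict_mono_onI)
    fix r s assume rs: "r \<in> {a..b}" "s \<in> {a..b}" "r < s"
    then have "{r..<s} \<subseteq> {a..<b}" by auto
    then show "w r < w s"
      using lift_Suc_mono_less_ivl[of ?N w r s] ascent N rs(3) by blast
  qed
  have "strict_mono_on {1..k} w" "strict_mono_on {k+1..n} w"
    using assms(2) by (intro mono; force)+
  then show ?thesis using assms(1) by (simp add: grassmannian_def)
qed

lemma strict_mono_on_eq_if_image_eq:
  fixes f g :: "'a::linorder \<Rightarrow> 'b::linorder"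
  assumes "finite A" "strict_mono_on A f" "strict_mono_on A g" "f ` A = g ` A" "x \<in> A"
  shows "f x = g x"
proof -
  let ?xs = "sorted_list_of_set A"
  have "sorted_wrt (<) (map h ?xs)" if "strict_mono_on A h" for h :: "'a \<Rightarrow> 'b"
    unfolding sorted_wrt_map
    by (rule sorted_wrt_mono_rel[OF _ strict_sorted_list_of_set])
      (use that assms(1) in \<open>simp add: strict_mono_onD\<close>)
  then have "map f ?xs = map g ?xs"
    using assms by (intro sorted_distinct_set_unique) (auto simp: strict_sorted_iff)
  then show ?thesis using assms(1,5) by simp
qed

lemma grassmannian_eqI:
  assumes "w \<in> grassmannian n k" "u \<in> grassmannian n k" "k \<le> n" "w ` {1..k} = u ` {1..k}"
  shows "w = u"
proof
  fix x
  have Sn: "w \<in> Sn n" "u \<in> Sn n" using assms(1,2) by (auto dest: grassmannian_imp_Sn)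
  moreover have "{k+1..n} = {1..n} - {1..k}" using assms(3) by auto
  ultimately have upper_image: "w ` {k+1..n} = u ` {k+1..n}"
    using assms(4) by (simp add: image_set_diff inj_Sn Sn_image del: One_nat_def)
  consider (lower) "x \<in> {1..k}" | (upper) "x \<in> {k+1..n}" | (outside) "x \<notin> {1..n}"
    using assms(3) by fastforce
  then show "w x = u x"
  proof cases
    case lower
    then show ?thesis
      using assms
      by (intro strict_mono_on_eq_if_image_eq[of "{1..k}"]) (auto simp: grassmannian_def)
  next
    case upper
    then show ?thesis
      using assms upper_image
      by (intro strict_mono_on_eq_if_image_eq[of "{k+1..n}"]) (auto simp: grassmannian_def)
  next
    case outside
    then show ?thesis using Sn by (simp add: Sn_def permutes_not_in del: atLeastAtMost_iff)
  qed
qed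

lemma grassmannian_factorization:
  assumes "w \<in> Sn n" "k \<le> n"
  obtains g v where "g \<in> grassmannian n k" "v \<in> young n k" "w = g \<circ> v"
proof -
  \<comment> \<open>The Grassmannian factor is the shortest element of the coset of \<open>w\<close>.\<close>
  obtain v where v: "v \<in> young n k"
    and minimal: "\<And>u. u \<in> young n k \<Longrightarrow> plen n (w \<circ> v) \<le> plen n (w \<circ> u)"
    using ex_has_least_nat[of "\<lambda>v. v \<in> young n k" id "\<lambda>v. plen n (w \<circ> v)"] by auto
  have "w \<circ> v \<in> grassmannian n k"
  proof (rule grassmannianI)
    show "w \<circ> v \<in> Sn n" using assms(1) young_imp_Sn[OF v] by (rule comp_in_Sn)
    show "\<not> (w \<circ> v) (Suc i) < (w \<circ> v) i" if i: "1 \<le> i" "i < n" "i \<noteq> k" for i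
      using plen_comp_adj_descent[of i n "w \<circ> v"] minimal[of "v \<circ> adj i"] v i
      by (fastforce simp: comp_adj_in_young comp_assoc)
  qed (rule assms(2))
  moreover have "inv v \<in> young n k" using v by (rule inv_in_young)
  moreover have "bij v" using v by (intro bij_Sn young_imp_Sn)
  then have "w = w \<circ> v \<circ> inv v" by (simp add: fun_eq_iff bij_is_surj surj_f_inv_f)
  ultimately show thesis by (rule that)
qed

lemma grassmannian_comp_young_ascent:
  assumes "w \<in> grassmannian n k" "v \<in> young n k" "k \<le> n" "1 \<le> i" "i < n" "i \<noteq> k" "v i < v (Suc i)"
  shows "w (v i) < w (v (Suc i))"
proof -
  have "v ` {1..k} = {1..k}" using assms(2) by (simp add: young_def)
  then have "{v i, v (Suc i)} \<subseteq> {1..k} \<or> {v i, v (Suc i)} \<subseteq> {k+1..n}"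
    using young_upper_block[OF assms(2,3)] assms(4-6)
    by (cases "i < k") (auto simp del: One_nat_def)
  then show ?thesis
    using assms(1,7) unfolding grassmannian_def strict_mono_on_def by blast
qed

lemma young_induct [consumes 2, case_names id ascent]:
  assumes "v \<in> young n k" "k \<le> n"
    and id: "P id"
    and ascent: "\<And>v i. v \<in> young n k \<Longrightarrow> 1 \<le> i \<Longrightarrow> i < n \<Longrightarrow> i \<noteq> k \<Longrightarrow> v i < v (Suc i) \<Longrightarrow>
      v \<circ> adj i \<in> young n k \<Longrightarrow> P v \<Longrightarrow> P (v \<circ> adj i)"
  shows "P v"
  using assms(1)
proof (induction "plen n v" arbitrary: v rule: less_induct)
  case less
  show ?case
  proof (cases "v \<in> grassmannian n k")
    case True
    have "v ` {1..k} = id ` {1..k}" using less.prems by (simp add: young_def)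
    then have "v = id" using grassmannian_eqI[OF True id_in_grassmannian assms(2)] by blast
    then show ?thesis using id by simp
  next
    case False
    then obtain i where i: "1 \<le> i" "i < n" "i \<noteq> k" "v (Suc i) < v i"
      using grassmannianI[OF _ assms(2)] less.prems young_imp_Sn by blast
    let ?u = "v \<circ> adj i"
    have u: "?u \<in> young n k" using less.prems i by (intro comp_adj_in_young)
    have "P ?u" using plen_comp_adj_descent[of i n v] i by (intro less.hyps u) simp
    then show ?thesis using ascent[OF u i(1-3)] i less.prems by simp
  qed
qed

lemmas Sn_induct = young_induct[where k = n and n = n for n, folded Sn_eq_young, OF _ order_refl,
    consumes 1, case_names id ascent]

lemma card_less_pairs:
  fixes A :: "'a::linorder set"
  assumes "finite A"
  shows "card {(a, b). a \<in> A \<and> b \<in> A \<and> a < b} = card A choose 2"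
proof -
  have "bij_betw (\<lambda>(a, b). {a, b}) {(a, b). a \<in> A \<and> b \<in> A \<and> a < b} {B. B \<subseteq> A \<and> card B = 2}"
    unfolding bij_betw_def
  proof
    show "inj_on (\<lambda>(a, b). {a, b}) {(a, b). a \<in> A \<and> b \<in> A \<and> a < b}"
      by (auto simp: inj_on_def doubleton_eq_iff)
    have "{a, b} \<in> (\<lambda>(a, b). {a, b}) ` {(a, b). a \<in> A \<and> b \<in> A \<and> a < b}"
      if "a \<in> A" "b \<in> A" "a \<noteq> b" for a b
      using that by (cases a b rule: linorder_cases) (force simp: insert_commute)+
    then show "(\<lambda>(a, b). {a, b}) ` {(a, b). a \<in> A \<and> b \<in> A \<and> a < b} = {B. B \<subseteq> A \<and> card B = 2}"
      by (auto simp: card_2_iff)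
  qed
  then have "card {(a, b). a \<in> A \<and> b \<in> A \<and> a < b} = card {B. B \<subseteq> A \<and> card B = 2}"
    by (rule bij_betw_same_card)
  then show ?thesis using assms by (simp only: n_subsets)
qed

lemma plen_young_le_dkn:
  assumes "v \<in> young n k" "k \<le> n"
  shows "plen n v \<le> dkn n k"
proof -
  let ?pairs = "\<lambda>A::nat set. {(a, b). a \<in> A \<and> b \<in> A \<and> a < b}"
  have images: "v ` {1..k} = {1..k}" "v ` {k+1..n} = {k+1..n}"
    using assms young_upper_block[OF assms] by (auto simp: young_def)
  have "\<not> (i \<le> k \<and> k < j)" if "(i, j) \<in> inversions n v" for i j
  proof
    assume "i \<le> k \<and> k < j"
    then have "v i \<in> {1..k}" "v j \<in> {k+1..n}" using that images by (auto simp: inversions_def)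
    then show False using that by (simp add: inversions_def)
  qed
  then have "inversions n v \<subseteq> ?pairs {1..k} \<union> ?pairs {k+1..n}"
    by (fastforce simp: inversions_def)
  moreover have "finite (?pairs {1..k})" "finite (?pairs {k+1..n})"
    by (auto intro: finite_subset[of _ "{1..k} \<times> {1..k}"] finite_subset[of _ "{k+1..n} \<times> {k+1..n}"])
  ultimately have "plen n v \<le> card (?pairs {1..k} \<union> ?pairs {k+1..n})"
    unfolding plen_eq_card_inversions by (intro card_mono) auto
  also have "\<dots> \<le> card (?pairs {1..k}) + card (?pairs {k+1..n})" by (rule card_Un_le)
  also have "\<dots> = dkn n k"
    by (simp only: card_less_pairs finite_atLeastAtMost card_atLeastAtMost dkn_def) simp
  finally show ?thesis .
qed

subsection \<open>Partitions in a rectangle\<close>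

lemma finite_parts [simp]: "finite (parts n k)"
proof (rule finite_subset)
  show "parts n k \<subseteq> {xs. set xs \<subseteq> {..n - k} \<and> length xs = k}"
    by (auto simp: parts_def in_set_conv_nth)
qed (simp add: finite_lists_length_eq)

lemma inj_on_extend_permutes:
  assumes "finite B" "A \<subseteq> B" "inj_on f A" "f ` A \<subseteq> B"
  obtains w where "w permutes B" "\<And>x. x \<in> A \<Longrightarrow> w x = f x"
proof -
  have "finite A" using assms(1,2) finite_subset by blast
  then have "card (B - A) = card (B - f ` A)"
    using assms by (simp add: card_Diff_subset card_image)
  then obtain g where g: "bij_betw g (B - A) (B - f ` A)"
    using finite_same_card_bij[of "B - A" "B - f ` A"] assms(1) by auto
  define w where "w x = (if x \<in> A then f x else if x \<in> B then g x else x)" for x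
  have "bij_betw w A (f ` A)" using assms(3) by (auto simp: w_def bij_betw_def inj_on_def)
  moreover have "bij_betw w (B - A) (B - f ` A)"
    using g by (rule iffD1[OF bij_betw_cong, rotated]) (simp add: w_def)
  ultimately have "bij_betw w (A \<union> (B - A)) (f ` A \<union> (B - f ` A))"
    by (rule bij_betw_combine) auto
  moreover have "A \<union> (B - A) = B" "f ` A \<union> (B - f ` A) = B" using assms by auto
  ultimately have "w permutes B" using assms(2) by (intro bij_imp_permutes) (auto simp: w_def)
  then show thesis by (rule that) (simp add: w_def)
qed

lemma parts_antimono: "lam \<in> parts n k \<Longrightarrow> i \<le> j \<Longrightarrow> j < k \<Longrightarrow> lam ! j \<le> lam ! i"
  by (auto simp: parts_def sorted_rev_iff_nth_mono)

lemma strict_mono_on_parts_shift: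
  assumes "lam \<in> parts n k"
  shows "strict_mono_on {1..k} (\<lambda>j. lam ! (k - j) + j)"
proof (rule strict_mono_onI)
  fix i j assume "i \<in> {1..k}" "j \<in> {1..k}" "i < j"
  then show "lam ! (k - i) + i < lam ! (k - j) + j"
    using parts_antimono[OF assms, of "k - j" "k - i"] by (simp add: add_le_less_mono)
qed

lemma wlam_conditions_iff:
  assumes "lam \<in> parts n k"
  shows "w permutes {1..n} \<and> (\<forall>i\<in>{1..k}. w (k + 1 - i) = lam ! (i - 1) + k + 1 - i)
      \<and> strict_mono_on {k+1..n} w
    \<longleftrightarrow> w \<in> grassmannian n k \<and> (\<forall>j\<in>{1..k}. w j = lam ! (k - j) + j)"
    (is "_ \<and> ?reversed \<and> _ \<longleftrightarrow> _ \<and> ?values")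
proof -
  have "?reversed \<longleftrightarrow> (\<forall>i\<in>(\<lambda>j. k + 1 - j) ` {1..k}. w (k + 1 - i) = lam ! (i - 1) + k + 1 - i)"
  proof -
    have "(\<lambda>j. k + 1 - j) ` {1..k} = {1..k}"
      by (rule bij_betw_imp_surj_on[OF bij_betw_byWitness[where f' = "\<lambda>j. k + 1 - j"]]) auto
    then show ?thesis by simp
  qed
  also have "\<dots> \<longleftrightarrow> (\<forall>j\<in>{1..k}. w (k + 1 - (k + 1 - j)) = lam ! (k + 1 - j - 1) + k + 1 - (k + 1 - j))"
    by simp
  also have "\<dots> \<longleftrightarrow> ?values" by (intro ball_cong) auto
  finally have "?reversed \<longleftrightarrow> ?values" .
  moreover have "strict_mono_on {1..k} w" if ?values
    using strict_mono_on_parts_shift[OF assms] that by (simp add: strict_mono_on_def)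
  ultimately show ?thesis by (auto simp: grassmannian_def Sn_def)
qed

lemma ex1_grassmannian_with_values:
  assumes "lam \<in> parts n k" "k \<le> n"
  shows "\<exists>!w. w \<in> grassmannian n k \<and> (\<forall>j\<in>{1..k}. w j = lam ! (k - j) + j)"
proof -
  let ?a = "\<lambda>j. lam ! (k - j) + j"
  have mono: "strict_mono_on {1..k} ?a" using assms(1) by (rule strict_mono_on_parts_shift)
  have "?a ` {1..k} \<subseteq> {1..n}"
  proof clarify
    fix j assume "j \<in> {1..k}"
    moreover from this have "lam ! (k - j) \<le> n - k" using assms(1) by (simp add: parts_def)
    ultimately show "?a j \<in> {1..n}" using assms(2) by auto
  qed
  then obtain w where w: "w permutes {1..n}" "\<And>j. j \<in> {1..k} \<Longrightarrow> w j = ?a j"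
    using inj_on_extend_permutes[of "{1..n}" "{1..k}" ?a] strict_mono_on_imp_inj_on[OF mono] assms(2)
    by (metis (lifting) finite_atLeastAtMost atLeastatMost_subset_iff order_refl)
  then obtain g v where g: "g \<in> grassmannian n k" and v: "v \<in> young n k" and factor: "w = g \<circ> v"
    using grassmannian_factorization[of w n k] assms(2) by (auto simp: Sn_def)
  have "g ` {1..k} = w ` {1..k}"
    using v unfolding factor image_comp[symmetric] by (simp add: young_def)
  also have "\<dots> = ?a ` {1..k}" using w(2) by (intro image_cong) auto
  finally have "g j = ?a j" if "j \<in> {1..k}" for j
    using g mono that
    by (intro strict_mono_on_eq_if_image_eq[of "{1..k}"]) (auto simp: grassmannian_def)
  moreover have "u = g"
    if "u \<in> grassmannian n k" "\<forall>j\<in>{1..k}. u j = ?a j" for u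
    using that calculation g assms(2) by (intro grassmannian_eqI[of u n k g] image_cong) auto
  ultimately show ?thesis using g by blast
qed

lemma
  assumes "lam \<in> parts n k" "k \<le> n"
  shows wlam_in_grassmannian: "wlam n k lam \<in> grassmannian n k"
    and wlam_lower: "j \<in> {1..k} \<Longrightarrow> wlam n k lam j = lam ! (k - j) + j"
proof -
  have "wlam n k lam = (THE w. w \<in> grassmannian n k \<and> (\<forall>j\<in>{1..k}. w j = lam ! (k - j) + j))"
    unfolding wlam_def wlam_conditions_iff[OF assms(1)] ..
  with theI'[OF ex1_grassmannian_with_values[OF assms]]
  show "wlam n k lam \<in> grassmannian n k" "j \<in> {1..k} \<Longrightarrow> wlam n k lam j = lam ! (k - j) + j"
    by simp_all
qed

lemma wlam_in_Sn: "lam \<in> parts n k \<Longrightarrow> k \<le> n \<Longrightarrow> wlam n k lam \<in> Sn n"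
  by (rule grassmannian_imp_Sn[OF wlam_in_grassmannian])

lemma wlam_eqI:
  assumes "g \<in> grassmannian n k" "lam \<in> parts n k" "k \<le> n"
    and "\<And>j. j \<in> {1..k} \<Longrightarrow> g j = lam ! (k - j) + j"
  shows "wlam n k lam = g"
  using ex1_grassmannian_with_values[OF assms(2,3)] wlam_in_grassmannian[OF assms(2,3)]
    wlam_lower[OF assms(2,3)] assms(1,4) by blast

lemma strict_mono_on_nat_gap:
  fixes g :: "nat \<Rightarrow> nat"
  assumes "strict_mono_on {a..b} g" "a \<le> i" "i \<le> j" "j \<le> b"
  shows "g i + (j - i) \<le> g j"
  using assms(3,4)
proof (induction j rule: dec_induct)
  case (step m)
  have "g m < g (Suc m)" using step assms(2) by (intro strict_mono_onD[OF assms(1)]) auto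
  then show ?case using step by auto
qed simp

lemma grassmannian_eq_wlam:
  assumes "g \<in> grassmannian n k" "k \<le> n"
  obtains lam where "lam \<in> parts n k" "wlam n k lam = g"
proof -
  define lam where "lam = map (\<lambda>i. g (k - i) - (k - i)) [0..<k]"
  have "strict_mono_on {1..k} g" using assms(1) by (simp add: grassmannian_def)
  note gap = strict_mono_on_nat_gap[OF this]
  have "g ` {1..n} = {1..n}" using assms(1) by (intro Sn_image grassmannian_imp_Sn)
  then have range: "1 \<le> g j \<and> g j \<le> n" if "1 \<le> j" "j \<le> k" for j
    using imageI[of j "{1..n}" g] that assms(2) by auto
  have lower: "j \<le> g j" if "1 \<le> j" "j \<le> k" for j
    using gap[of 1 j] range[of 1] that by auto
  have upper: "g j - j \<le> n - k" if "1 \<le> j" "j \<le> k" for j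
    using gap[of j k] range[of k] that assms(2) by auto
  have "sorted (rev lam)"
    unfolding sorted_rev_iff_nth_mono
  proof (intro allI impI)
    fix i j assume ij: "i \<le> j" "j < length lam"
    then have "g (k - j) + (k - i - (k - j)) \<le> g (k - i)" by (intro gap) (auto simp: lam_def)
    then show "lam ! j \<le> lam ! i" using ij by (simp add: lam_def)
  qed
  moreover have "lam ! i \<le> n - k" if "i < k" for i
    using upper[of "k - i"] that by (simp add: lam_def)
  ultimately have "lam \<in> parts n k" by (simp add: parts_def) (simp add: lam_def)
  moreover from this have "wlam n k lam = g"
    using assms lower by (intro wlam_eqI) (auto simp: lam_def)
  ultimately show thesis by (rule that)
qed

lemma wlam_factorization:
  assumes "w \<in> Sn n" "k \<le> n"
  obtains lam v where "lam \<in> parts n k" "v \<in> young n k" "w = wlam n k lam \<circ> v"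
  using assms by (metis grassmannian_factorization grassmannian_eq_wlam)

lemma wlam_factorization_unique:
  assumes "lam \<in> parts n k" "mu \<in> parts n k" "v \<in> young n k" "u \<in> young n k" "k \<le> n"
    and "wlam n k lam \<circ> v = wlam n k mu \<circ> u"
  shows "lam = mu \<and> v = u"
proof -
  have "v ` {1..k} = {1..k}" "u ` {1..k} = {1..k}" using assms(3,4) by (auto simp: young_def)
  then have "wlam n k lam ` {1..k} = wlam n k mu ` {1..k}"
    using arg_cong[OF assms(6), of "\<lambda>h. h ` {1..k}"] by (simp only: image_comp[symmetric])
  then have same_wlam: "wlam n k lam = wlam n k mu"
    using assms by (intro grassmannian_eqI[of _ n k]) (simp_all add: wlam_in_grassmannian)
  have "lam = mu"
  proof (rule nth_equalityI)
    show "length lam = length mu" using assms(1,2) by (simp add: parts_def)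
    fix i assume "i < length lam"
    then have "k - i \<in> {1..k}" "k - (k - i) = i" using assms(1) by (auto simp: parts_def)
    then show "lam ! i = mu ! i"
      using wlam_lower[OF assms(1,5), of "k - i"] wlam_lower[OF assms(2,5), of "k - i"] same_wlam by simp
  qed
  moreover have "v = u"
    using assms(6) same_wlam inj_Sn[OF wlam_in_Sn[OF assms(2,5)]] by (auto simp: fun_eq_iff inj_eq)
  ultimately show ?thesis by simp
qed

lemma wlam_factorization_bij:
  assumes "k \<le> n"
  shows "bij_betw (\<lambda>(lam, v). wlam n k lam \<circ> v) (parts n k \<times> young n k) (Sn n)"
  unfolding bij_betw_def
proof
  show "inj_on (\<lambda>(lam, v). wlam n k lam \<circ> v) (parts n k \<times> young n k)"
    using wlam_factorization_unique[OF _ _ _ _ assms] by (auto simp: inj_on_def)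
  show "(\<lambda>(lam, v). wlam n k lam \<circ> v) ` (parts n k \<times> young n k) = Sn n" (is "?L = _")
  proof
    show "?L \<subseteq> Sn n" using wlam_in_Sn[OF _ assms] by (auto intro!: comp_in_Sn dest: young_imp_Sn)
    show "Sn n \<subseteq> ?L" using assms by (auto elim!: wlam_factorization intro: rev_image_eqI)
  qed
qed

subsection \<open>Reduced words\<close>

lemma sprod_Nil [simp]: "sprod [] = id"
  by (simp add: sprod_def)

lemma sprod_Cons [simp]: "sprod (i # ws) = adj i \<circ> sprod ws"
  by (simp add: sprod_def)

lemma sprod_snoc: "sprod (ws @ [i]) = sprod ws \<circ> adj i"
  by (induction ws) (simp_all add: comp_assoc)

lemma sprod_in_Sn: "\<forall>i\<in>set ws. 1 \<le> i \<and> i < n \<Longrightarrow> sprod ws \<in> Sn n"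
  by (induction ws) (auto intro!: comp_in_Sn adj_in_Sn)

lemma plen_sprod_le: "\<forall>i\<in>set ws. 1 \<le> i \<and> i < n \<Longrightarrow> plen n (sprod ws) \<le> length ws"
proof (induction ws rule: rev_induct)
  case (snoc i ws)
  have "sprod ws \<in> Sn n" using snoc.prems by (intro sprod_in_Sn) simp
  then have "plen n (sprod (ws @ [i])) \<le> Suc (plen n (sprod ws))"
    unfolding sprod_snoc
    using plen_comp_adj_ascent[of i n "sprod ws"] plen_comp_adj_descent[of i n "sprod ws"] snoc.prems
    by (cases rule: Sn_ascent_cases[of _ _ i]) auto
  also have "\<dots> \<le> Suc (length ws)" using snoc by simp
  finally show ?case by simp
qed simp

lemma red_word_snoc_iff:
  assumes "1 \<le> i" "i < n"
  shows "red_word n w (ws @ [i]) \<longleftrightarrow> red_word n (w \<circ> adj i) ws \<and> w (Suc i) < w i"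
proof
  assume "red_word n w (ws @ [i])"
  then have letters: "\<forall>i\<in>set ws. 1 \<le> i \<and> i < n" and w: "w = sprod ws \<circ> adj i"
    and len: "plen n w = Suc (length ws)"
    by (auto simp: red_word_def sprod_snoc)
  have bound: "plen n (w \<circ> adj i) \<le> length ws" using plen_sprod_le[OF letters] w by simp
  have "w \<in> Sn n" using w assms sprod_in_Sn[OF letters] by (simp add: comp_adj_in_Sn)
  then show "red_word n (w \<circ> adj i) ws \<and> w (Suc i) < w i"
  proof (cases rule: Sn_ascent_cases[of _ _ i])
    case ascent
    then show ?thesis using plen_comp_adj_ascent[OF assms] bound len by simp
  next
    case descent
    then show ?thesis
      using plen_comp_adj_descent[OF assms] letters w len by (simp add: red_word_def)
  qed
next
  assume "red_word n (w \<circ> adj i) ws \<and> w (Suc i) < w i"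
  moreover from this have "sprod (ws @ [i]) = w" by (simp add: red_word_def sprod_snoc)
  ultimately show "red_word n w (ws @ [i])"
    using plen_comp_adj_descent[OF assms, of w] assms by (auto simp: red_word_def)
qed

lemma ex_red_word:
  assumes "w \<in> Sn n"
  shows "\<exists>ws. red_word n w ws"
  using assms
proof (induction rule: Sn_induct)
  case id
  have "red_word n id []" by (simp add: red_word_def)
  then show ?case by blast
next
  case (ascent v i)
  then obtain ws where "red_word n v ws" by blast
  then have "red_word n (v \<circ> adj i) (ws @ [i])"
    using ascent by (simp add: red_word_snoc_iff)
  then show ?case by blast
qed

lemma red_word_rword: "w \<in> Sn n \<Longrightarrow> red_word n w (rword n w)"
  unfolding rword_def using ex_red_word by (rule someI_ex)

lemma plen_left_ascent:
  assumes "w \<in> Sn n" "1 \<le> i" "i < n" "inv w i < inv w (Suc i)"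
  shows "plen n (adj i \<circ> w) = Suc (plen n w)"
proof -
  have "adj i \<circ> w \<in> Sn n" using assms by (intro comp_in_Sn adj_in_Sn)
  then have "plen n (adj i \<circ> w) = plen n (inv (adj i \<circ> w))" by (simp add: Sn_def plen_inv)
  also have "inv (adj i \<circ> w) = inv w \<circ> adj i" using bij_Sn[OF assms(1)] by (simp add: o_inv_distrib)
  also have "plen n (inv w \<circ> adj i) = Suc (plen n w)"
    using assms plen_comp_adj_ascent[of i n "inv w"] by (simp add: plen_inv Sn_def)
  finally show ?thesis .
qed

subsection \<open>Braid relations and products along reduced words\<close>

definition wprod :: "nat \<Rightarrow> (nat \<Rightarrow> 'a::monoid_mult) \<Rightarrow> (nat \<Rightarrow> nat) \<Rightarrow> 'a" where
  "wprod n g w = prod_list (map g (rword n w))"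

locale braid_family =
  fixes n :: nat and g :: "nat \<Rightarrow> 'a::monoid_mult"
  assumes far_commute: "\<And>i j. 1 \<le> i \<Longrightarrow> Suc i < j \<Longrightarrow> j < n \<Longrightarrow> g i * g j = g j * g i"
    and braid: "\<And>i. 1 \<le> i \<Longrightarrow> Suc i < n \<Longrightarrow> g i * g (Suc i) * g i = g (Suc i) * g i * g (Suc i)"
begin

abbreviation word :: "nat list \<Rightarrow> 'a" where
  "word ws \<equiv> prod_list (map g ws)"

lemma red_words_exchange_far:
  assumes "w \<in> Sn n" "1 \<le> i" "Suc i < j" "j < n" "w (Suc i) < w i" "w (Suc j) < w j"
  obtains us vs where "red_word n (w \<circ> adj i) us" "red_word n (w \<circ> adj j) vs"
    "word us * g i = word vs * g j"
proof -
  have j: "1 \<le> j" and i: "i < n" using assms(2-4) by auto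
  have "w \<circ> adj i \<circ> adj j \<in> Sn n" using assms i j by (intro comp_adj_in_Sn)
  then obtain zs where zs: "red_word n (w \<circ> adj i \<circ> adj j) zs" using ex_red_word by blast
  have "w \<circ> adj i \<circ> adj j = w \<circ> adj j \<circ> adj i"
    using assms(3) by (auto simp: fun_eq_iff transpose_def)
  then have "red_word n (w \<circ> adj i) (zs @ [j])" "red_word n (w \<circ> adj j) (zs @ [i])"
    using zs assms i j by (simp_all add: red_word_snoc_iff transpose_def)
  then show thesis by (rule that) (simp add: far_commute[OF assms(2-4)] mult.assoc)
qed

lemma red_words_exchange_near:
  assumes "w \<in> Sn n" "1 \<le> i" "Suc i < n" "w (Suc i) < w i" "w (Suc (Suc i)) < w (Suc i)"
  obtains us vs where "red_word n (w \<circ> adj i) us" "red_word n (w \<circ> adj (Suc i)) vs"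
    "word us * g i = word vs * g (Suc i)"
proof -
  have "w \<circ> adj i \<circ> adj (Suc i) \<circ> adj i \<in> Sn n" using assms by (intro comp_adj_in_Sn) auto
  then obtain zs where zs: "red_word n (w \<circ> adj i \<circ> adj (Suc i) \<circ> adj i) zs"
    using ex_red_word by blast
  have braid_perm: "w \<circ> adj i \<circ> adj (Suc i) \<circ> adj i = w \<circ> adj (Suc i) \<circ> adj i \<circ> adj (Suc i)"
    by (auto simp: fun_eq_iff transpose_def)
  have "red_word n (w \<circ> adj i \<circ> adj (Suc i)) (zs @ [i])"
    using zs assms by (simp add: red_word_snoc_iff transpose_def)
  then have us: "red_word n (w \<circ> adj i) ((zs @ [i]) @ [Suc i])"
    using assms by (subst red_word_snoc_iff) (auto simp: transpose_def)
  have "red_word n (w \<circ> adj (Suc i) \<circ> adj i) (zs @ [Suc i])"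
    using zs assms by (simp add: red_word_snoc_iff transpose_def flip: braid_perm)
  then have vs: "red_word n (w \<circ> adj (Suc i)) ((zs @ [Suc i]) @ [i])"
    using assms by (subst red_word_snoc_iff) (auto simp: transpose_def)
  have "g i * (g (Suc i) * g i) = g (Suc i) * (g i * g (Suc i))"
    using braid[of i] assms by (simp add: mult.assoc)
  then show thesis by (intro that[OF us vs]) (simp add: mult.assoc)
qed

lemma red_words_exchange:
  assumes "w \<in> Sn n" "i \<noteq> j" "1 \<le> i" "i < n" "1 \<le> j" "j < n" "w (Suc i) < w i" "w (Suc j) < w j"
  obtains us vs where "red_word n (w \<circ> adj i) us" "red_word n (w \<circ> adj j) vs"
    "word us * g i = word vs * g j"
proof -
  have thesis if "i < j" "1 \<le> i" "j < n" "w (Suc i) < w i" "w (Suc j) < w j"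
    and "\<And>us vs. red_word n (w \<circ> adj i) us \<Longrightarrow> red_word n (w \<circ> adj j) vs \<Longrightarrow>
      word us * g i = word vs * g j \<Longrightarrow> thesis" for i j and thesis
  proof (cases "j = Suc i")
    case True
    then show thesis using red_words_exchange_near[of w i] assms(1) that by metis
  next
    case False
    then have "Suc i < j" using that(1) by simp
    then show thesis using red_words_exchange_far[of w i j] assms(1) that by metis
  qed
  from this[of i j] this[of j i] show thesis
    using that assms by (metis linorder_neqE_nat)
qed

theorem matsumoto:
  "red_word n w us \<Longrightarrow> red_word n w vs \<Longrightarrow> word us = word vs"
proof (induction "length us" arbitrary: w us vs rule: less_induct)
  case less
  have len: "length us = length vs" using less.prems by (simp add: red_word_def)
  show ?case
  proof (cases us rule: rev_cases)
    case Nil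
    then show ?thesis using len by simp
  next
    case us: (snoc us' i)
    then obtain vs' j where vs: "vs = vs' @ [j]" using len by (cases vs rule: rev_cases) auto
    have ij: "1 \<le> i" "i < n" "1 \<le> j" "j < n" using less.prems us vs by (auto simp: red_word_def)
    have i: "red_word n (w \<circ> adj i) us'" "w (Suc i) < w i"
      using less.prems(1) us red_word_snoc_iff[OF ij(1,2)] by auto
    have j: "red_word n (w \<circ> adj j) vs'" "w (Suc j) < w j"
      using less.prems(2) vs red_word_snoc_iff[OF ij(3,4)] by auto
    have shorter: "length us' < length us" "length vs' < length us" using us vs len by auto
    show ?thesis
    proof (cases "i = j")
      case True
      then show ?thesis using less.hyps[OF shorter(1) i(1), of vs'] j(1) us vs by simp
    next
      case False
      have "w \<in> Sn n" using less.prems(1) sprod_in_Sn by (auto simp: red_word_def)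
      then obtain xs ys where "red_word n (w \<circ> adj i) xs" "red_word n (w \<circ> adj j) ys"
        and exchange: "word xs * g i = word ys * g j"
        using red_words_exchange[OF _ False ij i(2) j(2)] by blast
      then have "word us' = word xs" "word vs' = word ys"
        using less.hyps[OF shorter(1) i(1)] less.hyps[OF shorter(2) j(1)] by blast+
      then show ?thesis using exchange us vs by simp
    qed
  qed
qed

lemma wprod_red_word: "red_word n w ws \<Longrightarrow> wprod n g w = word ws"
  unfolding wprod_def rword_def using someI[of "red_word n w"] by (blast intro: matsumoto)

lemma wprod_id [simp]: "wprod n g id = 1"
  using wprod_red_word[of id "[]"] by (simp add: red_word_def)

lemma wprod_ascent:
  assumes "w \<in> Sn n" "1 \<le> i" "i < n" "w i < w (Suc i)"
  shows "wprod n g (w \<circ> adj i) = wprod n g w * g i"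
proof -
  have "red_word n (w \<circ> adj i) (rword n w @ [i])"
    using assms red_word_rword[OF assms(1)] by (simp add: red_word_snoc_iff)
  from wprod_red_word[OF this] show ?thesis by (simp add: wprod_def)
qed

lemma wprod_left_ascent:
  assumes "w \<in> Sn n" "1 \<le> i" "i < n" "inv w i < inv w (Suc i)"
  shows "wprod n g (adj i \<circ> w) = g i * wprod n g w"
proof -
  have "red_word n (adj i \<circ> w) (i # rword n w)"
    using plen_left_ascent[OF assms] assms red_word_rword[OF assms(1)] by (simp add: red_word_def)
  from wprod_red_word[OF this] show ?thesis by (simp add: wprod_def)
qed

lemma wprod_grassmannian_comp_young:
  assumes "v \<in> young n k" "k \<le> n" "w \<in> grassmannian n k"
  shows "wprod n g (w \<circ> v) = wprod n g w * wprod n g v"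
  using assms(1,2)
proof (induction rule: young_induct)
  case id
  show "wprod n g (w \<circ> id) = wprod n g w * wprod n g id" by simp
next
  case (ascent v i)
  have Sn: "v \<in> Sn n" "w \<in> Sn n"
    using ascent(1) assms(3) by (auto intro: young_imp_Sn grassmannian_imp_Sn)
  have "w (v i) < w (v (Suc i))"
    by (rule grassmannian_comp_young_ascent[OF assms(3) ascent(1) assms(2) ascent(2-5)])
  then have "wprod n g (w \<circ> v \<circ> adj i) = wprod n g (w \<circ> v) * g i"
    using ascent Sn by (intro wprod_ascent comp_in_Sn) auto
  then show "wprod n g (w \<circ> (v \<circ> adj i)) = wprod n g w * wprod n g (v \<circ> adj i)"
    using ascent Sn by (simp add: wprod_ascent comp_assoc mult.assoc)
qed

end

subsection \<open>The free algebra and its quotients\<close>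

instantiation list :: (type) monoid_add
begin
definition zero_list :: "'a list" where "zero_list = []"
definition plus_list :: "'a list \<Rightarrow> 'a list \<Rightarrow> 'a list" where "plus_list u w = u @ w"
instance by standard (auto simp: zero_list_def plus_list_def)
end

lemma poly_mapping_sum_single:
  fixes f :: "'k \<Rightarrow>\<^sub>0 'b::comm_monoid_add"
  shows "(\<Sum>k\<in>Poly_Mapping.keys f. Poly_Mapping.single k (Poly_Mapping.lookup f k)) = f"
  by (rule poly_mapping_eqI) (auto simp: lookup_sum lookup_single when_def in_keys_iff)

lemma poly_mapping_single_induct [case_names single add]:
  fixes f :: "'k \<Rightarrow>\<^sub>0 'b::comm_monoid_add"
  assumes single: "\<And>k c. P (Poly_Mapping.single k c)" and add: "\<And>f g. P f \<Longrightarrow> P g \<Longrightarrow> P (f + g)"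
  shows "P f"
proof -
  have "P (\<Sum>k\<in>S. Poly_Mapping.single k (Poly_Mapping.lookup f k))" for S
    using single[of undefined 0]
    by (induction S rule: infinite_finite_induct) (simp_all add: single add)
  then show ?thesis by (metis poly_mapping_sum_single)
qed

lemma additive_mult_if_mult_single:
  fixes F :: "('k::monoid_add \<Rightarrow>\<^sub>0 'b::ring) \<Rightarrow> 'c::ring"
  assumes "additive F"
    and single: "\<And>k l c d. k \<in> Poly_Mapping.keys f \<Longrightarrow> l \<in> Poly_Mapping.keys g \<Longrightarrow>
      F (Poly_Mapping.single k c * Poly_Mapping.single l d)
        = F (Poly_Mapping.single k c) * F (Poly_Mapping.single l d)"
  shows "F (f * g) = F f * F g"
proof -
  interpret additive F by (rule assms(1))
  let ?terms = "\<lambda>h :: 'k \<Rightarrow>\<^sub>0 'b.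
    \<Sum>k\<in>Poly_Mapping.keys h. Poly_Mapping.single k (Poly_Mapping.lookup h k)"
  have "F (?terms f * ?terms g) = F (?terms f) * F (?terms g)"
    by (simp add: sum_product sum single)
  then show ?thesis by (simp only: poly_mapping_sum_single)
qed

lemma fmul_eq_times: "fmul a b = a * b"
proof -
  let ?terms = "\<lambda>h :: fa. \<Sum>k\<in>Poly_Mapping.keys h. Poly_Mapping.single k (Poly_Mapping.lookup h k)"
  have "fmul a b = ?terms a * ?terms b"
    by (simp add: fmul_def sum_product mult_single plus_list_def)
  then show ?thesis by (simp only: poly_mapping_sum_single)
qed

lemma fone_eq_one: "fone = 1"
  by (simp add: fone_def fconst_def flip: single_one zero_list_def)

lemma fprod_eq_prod_list: "fprod xs = prod_list xs"
  by (induction xs) (simp_all add: fprod_def fmul_eq_times fone_eq_one)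

lemma fpow_eq_power: "fpow g j = fgen g ^ j"
  by (induction j) (simp_all add: fpow_def fprod_eq_prod_list)

lemma fcomm_eq: "fcomm a b = a * b - b * a"
  by (simp add: fcomm_def fmul_eq_times)

lemmas fa_ring_simps = fmul_eq_times fone_eq_one fprod_eq_prod_list fpow_eq_power fcomm_eq

lemma fconst_1: "fconst 1 = 1"
  by (simp flip: fone_def fone_eq_one)

lemma fconst_add: "fconst (c + d) = fconst c + fconst d"
  by (simp add: fconst_def single_add)

lemma fconst_mult: "fconst (c * d) = fconst c * fconst d"
  by (simp add: fconst_def mult_single plus_list_def)

lemma single_word: "Poly_Mapping.single u c = fconst c * prod_list (map fgen u)"
proof -
  have "prod_list (map fgen u) = Poly_Mapping.single u 1"
  proof (induction u)
    case Nil
    show ?case by (simp flip: single_one add: zero_list_def)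
  qed (simp add: fgen_def mult_single plus_list_def)
  then show ?thesis by (simp add: fconst_def mult_single plus_list_def)
qed

lemma fconst_commute: "fconst c * a = a * fconst c"
  by (induction a rule: poly_mapping_single_induct)
    (simp_all add: fconst_def mult_single plus_list_def mult.commute distrib_left distrib_right)

lemma lookup_fgen [simp]:
  "Poly_Mapping.lookup (fgen g) [] = 0" "Poly_Mapping.lookup (fgen g) [h] = (if g = h then 1 else 0)"
  by (simp_all add: fgen_def lookup_single when_def)

lemma lookup_times_Nil [simp]:
  fixes a b :: fa
  shows "Poly_Mapping.lookup (a * b) [] = Poly_Mapping.lookup a [] * Poly_Mapping.lookup b []"
proof (induction a rule: poly_mapping_single_induct)
  case (single u c)
  show ?case
    by (induction b rule: poly_mapping_single_induct)
      (auto simp: mult_single plus_list_def lookup_single when_def lookup_add distrib_left)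
qed (simp add: lookup_add distrib_right)

lemma lookup_times_singleton [simp]:
  fixes a b :: fa
  shows "Poly_Mapping.lookup (a * b) [g] = Poly_Mapping.lookup a [g] * Poly_Mapping.lookup b []
    + Poly_Mapping.lookup a [] * Poly_Mapping.lookup b [g]"
proof (induction a rule: poly_mapping_single_induct)
  case (single u c)
  show ?case
    by (induction b rule: poly_mapping_single_induct)
      (auto simp: mult_single plus_list_def lookup_single when_def append_eq_Cons_conv lookup_add
        distrib_left)
qed (simp add: lookup_add algebra_simps)

lemma fideal_times:
  assumes "x \<in> fideal R"
  shows "c * x \<in> fideal R" "x * c \<in> fideal R"
proof -
  have "c * x \<in> fideal R \<and> x * c \<in> fideal R"
    using assms
  proof induction
    case (gen r a b)
    then show ?case
      using fideal.gen[of r R "c * a" b] fideal.gen[of r R a "b * c"]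
      by (simp add: fmul_eq_times mult.assoc)
  qed (simp_all add: fideal.zero fideal.add distrib_left distrib_right)
  then show "c * x \<in> fideal R" "x * c \<in> fideal R" by simp_all
qed

lemma fideal_uminus: "x \<in> fideal R \<Longrightarrow> - x \<in> fideal R"
  using fideal_times(1)[of x R "-1"] by simp

lemma fideal_base: "r \<in> R \<Longrightarrow> r \<in> fideal R"
  using fideal.gen[of r R 1 1] by (simp add: fmul_eq_times)

lemma fideal_mono: "R \<subseteq> S \<Longrightarrow> fideal R \<subseteq> fideal S"
  by (rule subsetI, erule fideal.induct) (auto intro: fideal.intros)

lemma heq_mono: "R \<subseteq> S \<Longrightarrow> heq R a b \<Longrightarrow> heq S a b"
  using fideal_mono by (auto simp: heq_def)

lemma heq_refl: "heq R a a"
  by (simp add: heq_def fideal.zero)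

lemma heq_sym: "heq R a b \<Longrightarrow> heq R b a"
  unfolding heq_def using fideal_uminus[of "a - b" R] by simp

lemma heq_trans: "heq R a b \<Longrightarrow> heq R b c \<Longrightarrow> heq R a c"
  unfolding heq_def using fideal.add[of "a - b" R "b - c"] by simp

lemma heq_add: "heq R a b \<Longrightarrow> heq R c d \<Longrightarrow> heq R (a + c) (b + d)"
  unfolding heq_def using fideal.add[of "a - b" R "c - d"] by (simp add: algebra_simps)

lemma heq_uminus: "heq R a b \<Longrightarrow> heq R (- a) (- b)"
  unfolding heq_def using fideal_uminus[of "a - b" R] by simp

lemma heq_times:
  assumes "heq R a b" "heq R c d"
  shows "heq R (a * c) (b * d)"
proof -
  have "(a - b) * c + b * (c - d) \<in> fideal R"
    using assms by (intro fideal.add fideal_times) (simp_all add: heq_def)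
  then show ?thesis by (simp add: heq_def algebra_simps)
qed

definition augmented :: "fa set \<Rightarrow> bool" where
  "augmented R \<longleftrightarrow> (\<forall>r\<in>R. Poly_Mapping.lookup r [] = 0)"

lemma lookup_Nil_fideal: "x \<in> fideal R \<Longrightarrow> augmented R \<Longrightarrow> Poly_Mapping.lookup x [] = 0"
  by (induction rule: fideal.induct) (simp_all add: fmul_eq_times lookup_add augmented_def)

\<comment> \<open>Otherwise transfer would also unfold elements of the free algebra into functions.\<close>
lifting_forget poly_mapping.lifting

text \<open>HOL types cannot depend on a set of relations, so the quotients of the free algebra by all
  augmented sets of relations are collected in one product ring.\<close>

quotient_type fa_quotient = "fa set \<Rightarrow> fa" / "\<lambda>a b. \<forall>R. augmented R \<longrightarrow> heq R (a R) (b R)"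
  by (intro equivpI reflpI sympI transpI) (blast intro: heq_refl heq_sym heq_trans)+

instantiation fa_quotient :: ring_1
begin
lift_definition zero_fa_quotient :: fa_quotient is "\<lambda>_. 0" .
lift_definition one_fa_quotient :: fa_quotient is "\<lambda>_. 1" .
lift_definition plus_fa_quotient :: "fa_quotient \<Rightarrow> fa_quotient \<Rightarrow> fa_quotient" is "\<lambda>a b R. a R + b R"
  by (simp add: heq_add)
lift_definition uminus_fa_quotient :: "fa_quotient \<Rightarrow> fa_quotient" is "\<lambda>a R. - a R"
  by (simp add: heq_uminus)
lift_definition minus_fa_quotient :: "fa_quotient \<Rightarrow> fa_quotient \<Rightarrow> fa_quotient" is "\<lambda>a b R. a R - b R"
  using heq_add[OF _ heq_uminus] by simp
lift_definition times_fa_quotient :: "fa_quotient \<Rightarrow> fa_quotient \<Rightarrow> fa_quotient" is "\<lambda>a b R. a R * b R"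
  by (simp add: heq_times)
instance
proof
  have augmented: "augmented {}" by (simp add: augmented_def)
  moreover have "\<not> heq {} 0 1"
    using lookup_Nil_fideal[OF _ augmented, of "- 1"]
      lookup_one_zero[where ?'b = "gen list" and ?'a = rat]
    by (auto simp: heq_def zero_list_def)
  ultimately show "(0::fa_quotient) \<noteq> 1" by transfer blast
qed (transfer; simp add: heq_refl algebra_simps)+
end

text \<open>The augmentation in the components \<open>S \<noteq> R\<close> makes this map unital, and it kills all augmented
  relations there.\<close>

lift_definition fa_class :: "fa set \<Rightarrow> fa \<Rightarrow> fa_quotient" is
  "\<lambda>R a S. if S = R then a else fconst (Poly_Mapping.lookup a [])" .

lemma fa_class_eq_iff:
  assumes "augmented R"
  shows "fa_class R a = fa_class R b \<longleftrightarrow> heq R a b"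
proof -
  have "Poly_Mapping.lookup a [] = Poly_Mapping.lookup b []" if "heq R a b"
    using lookup_Nil_fideal[of "a - b" R] that assms by (simp add: heq_def lookup_minus)
  then show ?thesis using assms by transfer (auto simp: heq_refl)
qed

lemma fa_class_add: "fa_class R (a + b) = fa_class R a + fa_class R b"
  by transfer (simp add: lookup_add fconst_add heq_refl)

lemma fa_class_mult: "fa_class R (a * b) = fa_class R a * fa_class R b"
  by transfer (simp add: fconst_mult heq_refl)

lemma fa_class_1: "fa_class R 1 = 1"
  by transfer (simp add: heq_refl fconst_1 lookup_one zero_list_def)

lemma fa_class_relation: "r \<in> R \<Longrightarrow> augmented R \<Longrightarrow> fa_class R r = 0"
  by transfer (auto simp: augmented_def heq_def fideal_base fconst_def fideal.zero)

subsection \<open>Relations of the Hecke algebra\<close>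

text \<open>\<open>\<widehat>H\<^sub>n\<close> with a free central generator \<open>Gc\<close>: its relations hold both in the localized
  algebra and in every Schubert representation, where \<open>Gc\<close> acts by zero.\<close>

definition hrel_central :: "nat \<Rightarrow> fa set" where
  "hrel_central n = (hrel n - {fgen Gc}) \<union> {fcomm (fgen Gc) (fgen g) | g. True}"

lemma hrel_central_subset_hrel_loc: "hrel_central n \<subseteq> hrel_loc n k"
  by (auto simp: hrel_central_def hrel_loc_def)

lemma augmented_hrel_central: "augmented (hrel_central n)"
  unfolding augmented_def
proof
  fix r assume "r \<in> hrel_central n"
  then have "r \<in> hrel n \<or> (\<exists>g. r = fcomm (fgen Gc) (fgen g))" by (auto simp: hrel_central_def)
  then show "Poly_Mapping.lookup r [] = 0"
    unfolding hrel_def by (auto simp: fa_ring_simps lookup_minus lookup_add)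
qed

locale hecke_hom = additive \<phi> for n :: nat and \<phi> :: "fa \<Rightarrow> 'a::ring_1" +
  assumes mult: "\<phi> (a * b) = \<phi> a * \<phi> b"
    and one: "\<phi> 1 = 1"
    and relation: "r \<in> hrel_central n \<Longrightarrow> \<phi> r = 0"

lemma hecke_hom_fa_class: "hecke_hom n (fa_class (hrel_central n))"
  by standard
    (simp_all add: fa_class_add fa_class_mult fa_class_1 fa_class_relation augmented_hrel_central)

lemma braid_shift:
  fixes a b c d :: "'a::ring"
  assumes "c * a = a * c" "c * b = b * c" "a * a = d - c * a" "b * b = d - c * b"
    and "a * b * a = b * a * b"
  shows "(a + c) * (b + c) * (a + c) = (b + c) * (a + c) * (b + c)"
proof -
  have expand: "(a + c) * (b + c) * (a + c) =
      a * b * a + c * (a * b + b * a) + c * d + c * c * (a + b) + c * c * c"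
    if "c * a = a * c" "c * b = b * c" "a * a = d - c * a" for a b
  proof -
    have "(a + c) * (b + c) * (a + c) =
      a * b * a + a * b * c + a * c * a + a * c * c + c * b * a + c * b * c + c * c * a + c * c * c"
      by (simp add: algebra_simps)
    moreover have "a * b * c = c * (a * b)" "a * c * c = c * c * a" "c * b * c = c * c * b"
      using that(1,2) by (metis mult.assoc)+
    moreover have "a * c * a = c * d - c * c * a"
      using that(1,3) by (metis mult.assoc right_diff_distrib)
    ultimately show ?thesis by (simp add: algebra_simps)
  qed
  show ?thesis
    unfolding expand[OF assms(1,2,3)] expand[OF assms(2,1,4)] assms(5) by (simp add: add.commute)
qed

context hecke_hom
begin

abbreviation G :: "gen \<Rightarrow> 'a" where "G g \<equiv> \<phi> (fgen g)"
abbreviation p where "p \<equiv> G Gp"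
abbreviation q where "q \<equiv> G Gq"
abbreviation h where "h \<equiv> G Gh"
abbreviation T :: "nat \<Rightarrow> 'a" where "T i \<equiv> G (GT i)"
abbreviation x :: "nat \<Rightarrow> 'a" where "x i \<equiv> G (GX i)"
abbreviation Tbar :: "nat \<Rightarrow> 'a" where "Tbar i \<equiv> \<phi> (Tbar_i i)"
abbreviation Tbar_perm :: "(nat \<Rightarrow> nat) \<Rightarrow> 'a" where "Tbar_perm w \<equiv> \<phi> (Tbarw n w)"

lemma prod_list: "\<phi> (prod_list us) = prod_list (map \<phi> us)"
  by (induction us) (simp_all add: mult one)

lemma power: "\<phi> (a ^ j) = \<phi> a ^ j"
  by (induction j) (simp_all add: mult one)

lemmas hom_simps = add mult one zero minus diff sum power

lemma hom_single: "\<phi> (Poly_Mapping.single u c) = \<phi> (fconst c) * prod_list (map G u)"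
  by (simp add: single_word mult prod_list comp_def)

lemma fconst_central: "\<phi> (fconst c) * \<phi> a = \<phi> a * \<phi> (fconst c)"
  by (simp add: fconst_commute flip: mult)

lemma hrel_eq_0:
  assumes "r \<in> hrel n" "Poly_Mapping.lookup r [Gc] = 0"
  shows "\<phi> r = 0"
proof -
  have "r \<noteq> fgen Gc" using assms(2) by auto
  then show ?thesis using assms(1) relation by (auto simp: hrel_central_def)
qed

lemma scalar_commutes_gen:
  assumes "scal_gen s \<or> s = Gc"
  shows "G s * G g = G g * G s"
proof -
  have "\<phi> (fcomm (fgen s) (fgen g)) = 0"
  proof (cases "s = Gc")
    case True
    then show ?thesis by (intro relation) (auto simp: hrel_central_def)
  next
    case False
    then have "fcomm (fgen s) (fgen g) \<in> hrel n"
      using assms unfolding hrel_def Un_iff mem_Collect_eq by blast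
    then show ?thesis by (rule hrel_eq_0) (simp add: fcomm_eq lookup_minus)
  qed
  then show ?thesis by (simp add: fcomm_eq hom_simps)
qed

lemma scalar_central:
  assumes "scal_gen s \<or> s = Gc"
  shows "G s * \<phi> a = \<phi> a * G s"
proof (induction a rule: poly_mapping_single_induct)
  case (single u c)
  have "G s * prod_list (map G u) = prod_list (map G u) * G s"
    by (induction u)
      (simp_all add: scalar_commutes_gen[OF assms] mult.assoc flip: mult.assoc[of "G s"])
  then have "G s * (\<phi> (fconst c) * prod_list (map G u)) = \<phi> (fconst c) * prod_list (map G u) * G s"
    using fconst_central[of c "fgen s"] by (metis mult.assoc)
  then show ?case by (simp only: hom_single)
qed (simp add: add distrib_left distrib_right)

lemma p_central: "p * \<phi> a = \<phi> a * p" and q_central: "q * \<phi> a = \<phi> a * q"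
  by (simp_all add: scalar_central scal_gen_def)

lemma p_power_central: "p ^ j * \<phi> a = \<phi> a * p ^ j" and q_power_central: "q ^ j * \<phi> a = \<phi> a * q ^ j"
  by (intro power_commuting_commutes p_central q_central)+

lemma p_minus_q_central: "(p - q) * \<phi> a = \<phi> a * (p - q)"
  by (simp add: algebra_simps p_central q_central)

lemma pq_central: "p * q * \<phi> a = \<phi> a * (p * q)"
  by (metis mult.assoc p_central q_central)

lemma T_quadratic:
  assumes "1 \<le> i" "i < n"
  shows "T i * T i = p * q - (p - q) * T i"
proof -
  have "fmul (fgen (GT i) + fgen Gp) (fgen (GT i) - fgen Gq) \<in> hrel n"
    unfolding hrel_def Un_iff mem_Collect_eq using assms by blast
  from hrel_eq_0[OF this] show ?thesis
    using q_central[of "fgen (GT i)"]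
    by (simp add: fa_ring_simps lookup_add lookup_minus hom_simps algebra_simps)
qed

lemma T_commute:
  assumes "1 \<le> i" "Suc i < j" "j < n"
  shows "T i * T j = T j * T i"
proof -
  have "1 \<le> i \<and> i < n \<and> 1 \<le> j \<and> j < n \<and> Suc i < j" using assms by simp
  then have "fcomm (fgen (GT i)) (fgen (GT j)) \<in> hrel n"
    unfolding hrel_def Un_iff mem_Collect_eq by blast
  from hrel_eq_0[OF this] show ?thesis by (simp add: fa_ring_simps lookup_minus hom_simps)
qed

lemma T_braid:
  assumes "1 \<le> i" "Suc i < n"
  shows "T i * T (Suc i) * T i = T (Suc i) * T i * T (Suc i)"
proof -
  have "fprod [fgen (GT i), fgen (GT (Suc i)), fgen (GT i)]
    - fprod [fgen (GT (Suc i)), fgen (GT i), fgen (GT (Suc i))] \<in> hrel n"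
    unfolding hrel_def Un_iff mem_Collect_eq using assms by blast
  from hrel_eq_0[OF this] show ?thesis
    by (simp add: fa_ring_simps lookup_minus hom_simps mult.assoc)
qed

lemma T_x_far:
  assumes "1 \<le> i" "i < n" "1 \<le> j" "j \<le> n" "j \<noteq> i" "j \<noteq> Suc i"
  shows "T i * x j = x j * T i"
proof -
  have "fcomm (fgen (GT i)) (fgen (GX j)) \<in> hrel n"
    unfolding hrel_def Un_iff mem_Collect_eq using assms by blast
  from hrel_eq_0[OF this] show ?thesis by (simp add: fa_ring_simps lookup_minus hom_simps)
qed

lemma x_commute:
  assumes "1 \<le> i" "i \<le> n" "1 \<le> j" "j \<le> n"
  shows "x i * x j = x j * x i"
proof -
  have "fcomm (fgen (GX i)) (fgen (GX j)) \<in> hrel n"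
    unfolding hrel_def Un_iff mem_Collect_eq using assms by blast
  from hrel_eq_0[OF this] show ?thesis by (simp add: fa_ring_simps lookup_minus hom_simps)
qed

lemma T_x:
  assumes "1 \<le> i" "i < n"
  shows "T i * x i = x (Suc i) * T i + (h - (p - q) * x i)"
proof -
  have "fmul (fgen (GT i)) (fgen (GX i)) - (fmul (fgen (GX (Suc i))) (fgen (GT i))
    + (fgen Gh - fmul (fgen Gp - fgen Gq) (fgen (GX i)))) \<in> hrel n"
    unfolding hrel_def Un_iff mem_Collect_eq using assms by blast
  from hrel_eq_0[OF this] show ?thesis
    by (simp add: fa_ring_simps lookup_minus lookup_add hom_simps)
qed

lemma T_x_Suc:
  assumes "1 \<le> i" "i < n"
  shows "T i * x (Suc i) = x i * T i - (h - (p - q) * x i)"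
proof -
  have "fmul (fgen (GT i)) (fgen (GX (Suc i))) - (fmul (fgen (GX i)) (fgen (GT i))
    - (fgen Gh - fmul (fgen Gp - fgen Gq) (fgen (GX i)))) \<in> hrel n"
    unfolding hrel_def Un_iff mem_Collect_eq using assms by blast
  from hrel_eq_0[OF this] show ?thesis
    by (simp add: fa_ring_simps lookup_minus lookup_add hom_simps)
qed

lemma Tbar_eq: "Tbar i = T i + (p - q)"
  by (simp add: Tbar_i_def hom_simps)

lemma Tbar_T:
  assumes "1 \<le> i" "i < n"
  shows "Tbar i * T i = p * q"
  using T_quadratic[OF assms] by (simp add: Tbar_eq distrib_right)

lemma Tbar_quadratic:
  assumes "1 \<le> i" "i < n"
  shows "Tbar i * Tbar i = (p - q) * Tbar i + p * q"
proof -
  have "Tbar i * Tbar i = Tbar i * T i + Tbar i * (p - q)" by (simp add: Tbar_eq distrib_left)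
  then show ?thesis using Tbar_T[OF assms] p_minus_q_central[of "Tbar_i i"] by simp
qed

lemma Tbar_T_plus_p:
  assumes "1 \<le> i" "i < n"
  shows "Tbar i * (T i + p) = p * (T i + p)"
proof -
  have "Tbar i * (T i + p) = Tbar i * T i + p * Tbar i" by (simp add: distrib_left p_central)
  also have "\<dots> = p * (T i + p)" using Tbar_T[OF assms] by (simp add: Tbar_eq algebra_simps)
  finally show ?thesis .
qed

sublocale T: braid_family n T
  by standard (auto intro: T_commute T_braid)

sublocale Tbar: braid_family n Tbar
proof
  fix i j assume "1 \<le> i" "Suc i < j" "j < n"
  then show "Tbar i * Tbar j = Tbar j * Tbar i"
    using T_commute[of i j] p_minus_q_central[of "fgen (GT i)"] p_minus_q_central[of "fgen (GT j)"]
    by (simp add: Tbar_eq distrib_left distrib_right)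
next
  fix i assume "1 \<le> i" "Suc i < n"
  then show "Tbar i * Tbar (Suc i) * Tbar i = Tbar (Suc i) * Tbar i * Tbar (Suc i)"
    unfolding Tbar_eq using T_quadratic[of i] T_quadratic[of "Suc i"] T_braid[of i]
    by (intro braid_shift[where d = "p * q"] p_minus_q_central) auto
qed

lemma Tw_eq_wprod: "\<phi> (Tw n w) = wprod n T w"
  by (simp add: Tw_def wprod_def fprod_eq_prod_list prod_list comp_def)

lemma Tbarw_eq_wprod: "Tbar_perm w = wprod n Tbar w"
  by (simp add: Tbarw_def wprod_def fprod_eq_prod_list prod_list comp_def)

lemma Tbarw_id: "Tbar_perm id = 1"
  by (simp add: Tbarw_eq_wprod)

lemma Tbarw_ascent:
  "w \<in> Sn n \<Longrightarrow> 1 \<le> i \<Longrightarrow> i < n \<Longrightarrow> w i < w (Suc i) \<Longrightarrow> Tbar_perm (w \<circ> adj i) = Tbar_perm w * Tbar i"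
  by (simp add: Tbarw_eq_wprod Tbar.wprod_ascent)

lemma Tbarw_descent:
  assumes "w \<in> Sn n" "1 \<le> i" "i < n" "w (Suc i) < w i"
  shows "Tbar_perm w * Tbar i = (p - q) * Tbar_perm w + p * q * Tbar_perm (w \<circ> adj i)"
proof -
  have "Tbar_perm (w \<circ> adj i \<circ> adj i) = Tbar_perm (w \<circ> adj i) * Tbar i"
    using assms by (intro Tbarw_ascent comp_adj_in_Sn) auto
  then have w: "Tbar_perm w = Tbar_perm (w \<circ> adj i) * Tbar i" by simp
  then have "Tbar_perm w * Tbar i = Tbar_perm (w \<circ> adj i) * (Tbar i * Tbar i)"
    by (simp add: mult.assoc)
  also have "\<dots> = Tbar_perm (w \<circ> adj i) * Tbar i * (p - q) + Tbar_perm (w \<circ> adj i) * (p * q)"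
    using Tbar_quadratic[OF assms(2,3)] by (simp add: distrib_left p_minus_q_central mult.assoc)
  finally show ?thesis by (simp only: w[symmetric] p_minus_q_central pq_central)
qed

lemma Tbarw_grassmannian_comp_young:
  "v \<in> young n k \<Longrightarrow> k \<le> n \<Longrightarrow> w \<in> grassmannian n k \<Longrightarrow> Tbar_perm (w \<circ> v) = Tbar_perm w * Tbar_perm v"
  by (simp add: Tbarw_eq_wprod Tbar.wprod_grassmannian_comp_young)

end

subsection \<open>Commutative polynomials\<close>

definition poly_gens :: "nat \<Rightarrow> gen set" where
  "poly_gens n = {g. scal_gen g \<or> (\<exists>i. g = GX i \<and> 1 \<le> i \<and> i \<le> n)}"

definition mvar :: "gen \<Rightarrow> mpoly" where
  "mvar g = Poly_Mapping.single (Poly_Mapping.single g 1) 1"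

definition mconst :: "rat \<Rightarrow> mpoly" where
  "mconst c = Poly_Mapping.single 0 c"

lemma is_Ahx_iff: "is_Ahx n f \<longleftrightarrow> (\<forall>m\<in>Poly_Mapping.keys f. Poly_Mapping.keys m \<subseteq> poly_gens n)"
  by (auto simp: is_Ahx_def poly_gens_def)

lemma mconst_1: "mconst 1 = 1"
  by (simp add: mconst_def)

lemma mconst_0: "mconst 0 = 0"
  by (simp add: mconst_def)

lemma is_Ahx_mconst: "is_Ahx n (mconst c)"
  by (simp add: is_Ahx_def mconst_def)

lemma is_Ahx_mvar: "g \<in> poly_gens n \<Longrightarrow> is_Ahx n (mvar g)"
  by (simp add: is_Ahx_iff mvar_def)

lemma is_Ahx_add: "is_Ahx n f \<Longrightarrow> is_Ahx n g \<Longrightarrow> is_Ahx n (f + g)"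
  unfolding is_Ahx_def using keys_add[of f g] by blast

lemma is_Ahx_mult:
  assumes "is_Ahx n f" "is_Ahx n g"
  shows "is_Ahx n (f * g)"
  unfolding is_Ahx_iff
proof
  fix m assume "m \<in> Poly_Mapping.keys (f * g)"
  then obtain a b where "m = a + b" "a \<in> Poly_Mapping.keys f" "b \<in> Poly_Mapping.keys g"
    using keys_mult[of f g] by blast
  then show "Poly_Mapping.keys m \<subseteq> poly_gens n"
    using assms keys_add[of a b] unfolding is_Ahx_iff by blast
qed

lemma is_Ahx_uminus: "is_Ahx n f \<Longrightarrow> is_Ahx n (- f)"
  by (simp add: is_Ahx_def in_keys_iff)

lemma is_Ahx_diff: "is_Ahx n f \<Longrightarrow> is_Ahx n g \<Longrightarrow> is_Ahx n (f - g)"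
  using is_Ahx_add[of n f "- g"] by (simp add: is_Ahx_uminus)

lemma is_Ahx_0: "is_Ahx n 0" and is_Ahx_1: "is_Ahx n 1"
  using is_Ahx_mconst[of n] by (metis mconst_0, metis mconst_1)

lemma is_Ahx_sum: "(\<And>a. a \<in> A \<Longrightarrow> is_Ahx n (F a)) \<Longrightarrow> is_Ahx n (sum F A)"
  by (induction A rule: infinite_finite_induct) (simp_all add: is_Ahx_0 is_Ahx_add)

lemma is_Ahx_power: "is_Ahx n f \<Longrightarrow> is_Ahx n (f ^ j)"
  by (induction j) (simp_all add: is_Ahx_1 is_Ahx_mult)

lemmas is_Ahx_intros = is_Ahx_0 is_Ahx_1 is_Ahx_mvar is_Ahx_add is_Ahx_mult is_Ahx_uminus is_Ahx_diff
  is_Ahx_sum is_Ahx_power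

lemma poly_gens_scalars [simp]: "Gp \<in> poly_gens n" "Gq \<in> poly_gens n" "Gh \<in> poly_gens n"
  and poly_gens_GX [simp]: "GX i \<in> poly_gens n \<longleftrightarrow> 1 \<le> i \<and> i \<le> n"
  by (auto simp: poly_gens_def scal_gen_def)

lemma single_eq_prod_mvar:
  "Poly_Mapping.single m c = mconst c * (\<Prod>g\<in>Poly_Mapping.keys m. mvar g ^ Poly_Mapping.lookup m g)"
proof -
  have power: "mvar g ^ j = Poly_Mapping.single (Poly_Mapping.single g j) 1" for g j
    by (induction j) (simp_all add: mvar_def mult_single flip: single_add)
  have "(\<Prod>g\<in>A. Poly_Mapping.single (Poly_Mapping.single g (Poly_Mapping.lookup m g)) 1 :: mpoly)
    = Poly_Mapping.single (\<Sum>g\<in>A. Poly_Mapping.single g (Poly_Mapping.lookup m g)) 1" for A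
    by (induction A rule: infinite_finite_induct) (simp_all add: mult_single)
  then show ?thesis by (simp add: power poly_mapping_sum_single mconst_def mult_single)
qed

lemma is_Ahx_induct [consumes 1, case_names const var add mult]:
  assumes "is_Ahx n f"
    and const: "\<And>c. P (mconst c)" and var: "\<And>g. g \<in> poly_gens n \<Longrightarrow> P (mvar g)"
    and add: "\<And>f g. is_Ahx n f \<Longrightarrow> is_Ahx n g \<Longrightarrow> P f \<Longrightarrow> P g \<Longrightarrow> P (f + g)"
    and mult: "\<And>f g. is_Ahx n f \<Longrightarrow> is_Ahx n g \<Longrightarrow> P f \<Longrightarrow> P g \<Longrightarrow> P (f * g)"
  shows "P f"
proof -
  define Q where "Q f \<longleftrightarrow> is_Ahx n f \<and> P f" for f
  have Q_const: "Q (mconst c)" for c by (simp add: Q_def const is_Ahx_mconst)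
  have Q_mult: "Q f \<Longrightarrow> Q g \<Longrightarrow> Q (f * g)" for f g by (simp add: Q_def mult is_Ahx_mult)
  have Q_var: "Q (mvar g)" if "g \<in> poly_gens n" for g
    using that by (simp add: Q_def var is_Ahx_mvar)
  have Q_power: "Q (mvar g ^ j)" if "g \<in> poly_gens n" for g j
    using Q_const[of 1] that by (induction j) (simp_all add: mconst_1 Q_mult Q_var)
  have "Q (Poly_Mapping.single m c)" if "Poly_Mapping.keys m \<subseteq> poly_gens n" for m c
  proof -
    have "Q (\<Prod>g\<in>A. mvar g ^ Poly_Mapping.lookup m g)" if "A \<subseteq> poly_gens n" for A
      using that Q_const[of 1]
      by (induction A rule: infinite_finite_induct) (simp_all add: mconst_1 Q_mult Q_power)
    then show ?thesis unfolding single_eq_prod_mvar[of m c] using that by (intro Q_mult Q_const)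
  qed
  then have "Q (\<Sum>m\<in>A. Poly_Mapping.single m (Poly_Mapping.lookup f m))"
    if "\<And>m. m \<in> A \<Longrightarrow> Poly_Mapping.keys m \<subseteq> poly_gens n" for A
    using that Q_const[of 0]
    by (induction A rule: infinite_finite_induct) (simp_all add: mconst_0 Q_def add is_Ahx_add)
  from this[of "Poly_Mapping.keys f"] show ?thesis
    using assms(1) by (simp add: poly_mapping_sum_single is_Ahx_iff Q_def)
qed

definition monomial_rename :: "(nat \<Rightarrow> nat) \<Rightarrow> (gen \<Rightarrow>\<^sub>0 nat) \<Rightarrow> (gen \<Rightarrow>\<^sub>0 nat)" where
  "monomial_rename s m =
    (\<Sum>g\<in>Poly_Mapping.keys m. Poly_Mapping.single (gen_rename s g) (Poly_Mapping.lookup m g))"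

lemma monomial_rename_add: "monomial_rename s (m + m') = monomial_rename s m + monomial_rename s m'"
  unfolding monomial_rename_def by (rule setsum_keys_plus_distrib) (simp_all add: single_add)

lemma mp_rename_single:
  "mp_rename s (Poly_Mapping.single m c) = Poly_Mapping.single (monomial_rename s m) c"
  by (cases "c = 0") (simp_all add: mp_rename_def monomial_rename_def)

lemma mp_rename_add: "mp_rename s (f + g) = mp_rename s f + mp_rename s g"
  unfolding mp_rename_def by (rule setsum_keys_plus_distrib) (simp_all add: single_add)

lemma mp_rename_mult: "mp_rename s (f * g) = mp_rename s f * mp_rename s g"
  by (rule additive_mult_if_mult_single)
    (simp_all add: additive.intro mp_rename_add mp_rename_single mult_single monomial_rename_add)

lemma mp_rename_mconst: "mp_rename s (mconst c) = mconst c"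
  by (simp add: mconst_def mp_rename_single monomial_rename_def)

lemma mp_rename_mvar: "mp_rename s (mvar g) = mvar (gen_rename s g)"
  by (simp add: mvar_def mp_rename_single monomial_rename_def)

lemma gen_rename_GX: "gen_rename s (GX i) = GX (s i)"
  by (simp add: gen_rename_def)

lemma gen_rename_scalar: "scal_gen g \<Longrightarrow> gen_rename s g = g"
  by (auto simp: scal_gen_def gen_rename_def)

lemma gen_rename_poly_gens:
  assumes "s permutes {1..n}" "g \<in> poly_gens n"
  shows "gen_rename s g \<in> poly_gens n"
  using assms permutes_in_image[OF assms(1)]
  by (auto simp: poly_gens_def gen_rename_GX gen_rename_scalar simp del: One_nat_def)

lemma is_Ahx_mp_rename:
  assumes "is_Ahx n f" "s permutes {1..n}"
  shows "is_Ahx n (mp_rename s f)"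
  using assms(1)
  by (induction rule: is_Ahx_induct)
    (simp_all add: mp_rename_mconst mp_rename_mvar mp_rename_add mp_rename_mult is_Ahx_mconst
      is_Ahx_intros gen_rename_poly_gens[OF assms(2)])

lemma is_Ahx_mp_rename_adj: "is_Ahx n f \<Longrightarrow> 1 \<le> i \<Longrightarrow> i < n \<Longrightarrow> is_Ahx n (mp_rename (adj i) f)"
  by (intro is_Ahx_mp_rename adj_permutes)

lemma count_mono_word: "count (mset (mono_word m)) g = Poly_Mapping.lookup m g"
proof -
  let ?power = "\<lambda>g. replicate (Poly_Mapping.lookup m g) g"
  have "\<exists>gs. distinct gs \<and> set gs = Poly_Mapping.keys m"
    using finite_distinct_list[OF finite_keys[of m]] by metis
  then have "distinct (SOME gs. distinct gs \<and> set gs = Poly_Mapping.keys m)"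
    and "set (SOME gs. distinct gs \<and> set gs = Poly_Mapping.keys m) = Poly_Mapping.keys m"
    by (metis (mono_tags, lifting) someI_ex)+
  moreover have "count (mset (concat (map ?power gs))) g
    = (if g \<in> set gs then Poly_Mapping.lookup m g else 0)"
    if "distinct gs" for gs
    using that by (induction gs) auto
  ultimately show ?thesis unfolding mono_word_def by (simp add: in_keys_iff)
qed

lemma mset_mono_word_add: "mset (mono_word (m + m')) = mset (mono_word m @ mono_word m')"
  by (rule multiset_eqI) (simp add: count_mono_word lookup_add)

lemma set_mono_word: "set (mono_word m) = Poly_Mapping.keys m"
  by (metis (no_types, lifting) count_mono_word count_mset_0_iff in_keys_iff set_eqI)

lemma mono_word_0: "mono_word 0 = []"
  using set_mono_word[of 0] by simp

lemma mono_word_single_1: "mono_word (Poly_Mapping.single g 1) = [g]"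
proof -
  have "mset (mono_word (Poly_Mapping.single g 1)) = {#g#}"
    by (rule multiset_eqI) (simp add: count_mono_word lookup_single when_def)
  then show ?thesis by simp
qed

lemma mp_to_fa_add: "mp_to_fa (f + g) = mp_to_fa f + mp_to_fa g"
  unfolding mp_to_fa_def by (rule setsum_keys_plus_distrib) (simp_all add: single_add)

lemma mp_to_fa_single: "mp_to_fa (Poly_Mapping.single m c) = Poly_Mapping.single (mono_word m) c"
  by (cases "c = 0") (simp_all add: mp_to_fa_def)

lemma prod_list_commuting_cong:
  fixes F :: "'b \<Rightarrow> 'c::monoid_mult"
  assumes "mset us = mset vs" "\<And>a b. a \<in> set us \<Longrightarrow> b \<in> set us \<Longrightarrow> F a * F b = F b * F a"
  shows "prod_list (map F us) = prod_list (map F vs)"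
proof -
  have fold_eq: "prod_list (map F ws) = fold (\<lambda>a y. y * F a) ws 1" for ws
    by (induction ws rule: rev_induct) simp_all
  have "fold (\<lambda>a y. y * F a) us = fold (\<lambda>a y. y * F a) vs"
    by (rule fold_multiset_equiv) (use assms in \<open>auto simp: fun_eq_iff mult.assoc\<close>)
  then show ?thesis by (simp add: fold_eq)
qed

subsection \<open>Polynomials in the Hecke algebra\<close>

lemma twisted_leibniz:
  fixes t a a' b b' r d e :: "'a::ring"
  assumes "t * a = a' * t + r * d" "t * b = b' * t + r * e" "r * a' = a' * r"
  shows "t * (a * b) = a' * b' * t + r * (d * b + a' * e)"
proof -
  have "t * (a * b) = a' * (t * b) + r * d * b" using assms(1) by (metis distrib_right mult.assoc)
  also have "\<dots> = a' * b' * t + (a' * r * e + r * d * b)"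
    unfolding assms(2) by (simp add: distrib_left mult.assoc add.assoc)
  also have "\<dots> = a' * b' * t + r * (d * b + a' * e)"
    unfolding assms(3)[symmetric] by (simp add: distrib_left mult.assoc add.commute)
  finally show ?thesis .
qed

context hecke_hom
begin

abbreviation M :: "mpoly \<Rightarrow> 'a" where "M f \<equiv> \<phi> (mp_to_fa f)"

lemma poly_gens_commute:
  assumes "g \<in> poly_gens n" "g' \<in> poly_gens n"
  shows "G g * G g' = G g' * G g"
  using assms scalar_commutes_gen[of g g'] scalar_commutes_gen[of g' g] x_commute
  unfolding poly_gens_def by auto

sublocale M: additive M
  by standard (simp add: mp_to_fa_add add)

lemma M_single: "M (Poly_Mapping.single m c) = \<phi> (fconst c) * prod_list (map G (mono_word m))"
  by (simp add: mp_to_fa_single hom_single)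

lemma M_mconst: "M (mconst c) = \<phi> (fconst c)"
  by (simp add: mconst_def M_single mono_word_0)

lemma M_1: "M 1 = 1"
  using M_mconst[of 1] by (simp add: mconst_1 fconst_1 one)

lemma M_mvar: "M (mvar g) = G g"
  by (simp add: mvar_def M_single mono_word_single_1 fconst_1 one del: One_nat_def)

lemma M_mult:
  assumes "is_Ahx n f" "is_Ahx n g"
  shows "M (f * g) = M f * M g"
proof (rule additive_mult_if_mult_single)
  let ?W = "\<lambda>m. prod_list (map G (mono_word m))"
  fix m m' c d assume "m \<in> Poly_Mapping.keys f" "m' \<in> Poly_Mapping.keys g"
  then have "Poly_Mapping.keys m \<union> Poly_Mapping.keys m' \<subseteq> poly_gens n"
    using assms by (simp add: is_Ahx_iff)
  then have words: "?W (m + m') = ?W m * ?W m'"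
    using prod_list_commuting_cong[of "mono_word m @ mono_word m'" "mono_word (m + m')" G]
      poly_gens_commute
    by (fastforce simp: mset_mono_word_add set_mono_word)
  have const: "\<phi> (fconst d) * ?W m = ?W m * \<phi> (fconst d)"
    using fconst_central[of d "prod_list (map fgen (mono_word m))"]
    by (simp add: prod_list comp_def)
  have "M (Poly_Mapping.single m c * Poly_Mapping.single m' d)
    = \<phi> (fconst c) * (\<phi> (fconst d) * ?W m) * ?W m'"
    by (simp add: mult_single M_single fconst_mult mult words mult.assoc)
  also have "\<dots> = M (Poly_Mapping.single m c) * M (Poly_Mapping.single m' d)"
    by (simp only: const M_single mult.assoc)
  finally show "M (Poly_Mapping.single m c * Poly_Mapping.single m' d)
    = M (Poly_Mapping.single m c) * M (Poly_Mapping.single m' d)" .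
qed (rule M.additive_axioms)

lemma M_power: "is_Ahx n f \<Longrightarrow> M (f ^ j) = M f ^ j"
  by (induction j) (simp_all add: M_1 M_mult is_Ahx_power)

lemma M_commute: "is_Ahx n f \<Longrightarrow> is_Ahx n g \<Longrightarrow> M f * M g = M g * M f"
  by (metis M_mult mult.commute)

lemmas M_simps = M.add M.diff M.minus M.zero M_mult M_mvar M_1

text \<open>\<open>d\<close> is the divided difference of \<open>f\<close>, characterized without division.\<close>

definition bernstein :: "nat \<Rightarrow> mpoly \<Rightarrow> mpoly \<Rightarrow> bool" where
  "bernstein i f d \<longleftrightarrow> is_Ahx n d
    \<and> f - mp_rename (adj i) f = (mvar (GX i) - mvar (GX (Suc i))) * d
    \<and> T i * M f = M (mp_rename (adj i) f) * T i + (h - (p - q) * x i) * M d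
    \<and> T i * M (mp_rename (adj i) f) = M f * T i - (h - (p - q) * x i) * M d"

lemma bernstein_mconst: "bernstein i (mconst c) 0"
  using fconst_central[of c "fgen (GT i)"]
  by (simp add: bernstein_def mp_rename_mconst M_mconst M.zero is_Ahx_0)

lemma poly_gens_T_cases:
  assumes "1 \<le> i" "i < n" "g \<in> poly_gens n"
  obtains (x) "g = GX i" | (x_Suc) "g = GX (Suc i)"
    | (fixed) "T i * G g = G g * T i" "gen_rename (adj i) g = g"
proof -
  consider (scalar) "scal_gen g" | (var) j where "g = GX j" "1 \<le> j" "j \<le> n"
    using assms(3) by (auto simp: poly_gens_def)
  then show thesis
  proof cases
    case scalar
    then show thesis using fixed scalar_commutes_gen[of g "GT i"] by (simp add: gen_rename_scalar)
  next
    case var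
    then show thesis
      using that T_x_far[OF assms(1,2), of j]
      by (cases "j = i \<or> j = Suc i") (auto simp: gen_rename_GX)
  qed
qed

lemma bernstein_mvar:
  assumes "1 \<le> i" "i < n" "g \<in> poly_gens n"
  shows "\<exists>d. bernstein i (mvar g) d"
  using assms
proof (cases rule: poly_gens_T_cases)
  case x
  then have "bernstein i (mvar g) 1"
    using T_x[OF assms(1,2)] T_x_Suc[OF assms(1,2)]
    by (simp add: bernstein_def mp_rename_mvar gen_rename_GX M_mvar M_1 is_Ahx_1)
  then show ?thesis ..
next
  case x_Suc
  then have "bernstein i (mvar g) (- 1)"
    using T_x[OF assms(1,2)] T_x_Suc[OF assms(1,2)]
    by (simp add: bernstein_def mp_rename_mvar gen_rename_GX M_mvar M.minus M_1 is_Ahx_1 is_Ahx_uminus)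
  then show ?thesis ..
next
  case fixed
  then have "bernstein i (mvar g) 0"
    by (simp add: bernstein_def mp_rename_mvar M_mvar M.zero is_Ahx_0)
  then show ?thesis ..
qed

lemma bernstein_add: "bernstein i f d \<Longrightarrow> bernstein i g e \<Longrightarrow> bernstein i (f + g) (d + e)"
  by (simp add: bernstein_def mp_rename_add M.add is_Ahx_add distrib_left distrib_right add_diff_add
      add_ac)

lemma bernstein_mult:
  assumes "1 \<le> i" "i < n" "is_Ahx n f" "is_Ahx n g" "bernstein i f d" "bernstein i g e"
  shows "bernstein i (f * g) (d * g + mp_rename (adj i) f * e)"
proof -
  let ?s = "mp_rename (adj i)" and ?r = "mvar Gh - (mvar Gp - mvar Gq) * mvar (GX i)"
  have s_Ahx: "is_Ahx n (?s f)" "is_Ahx n (?s g)"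
    using assms(1-4) by (simp_all add: is_Ahx_mp_rename_adj)
  have r_Ahx: "is_Ahx n ?r" using assms(1,2) by (intro is_Ahx_intros) auto
  have r: "h - (p - q) * x i = M ?r" using assms(1,2) by (simp add: M_simps is_Ahx_intros)
  note f = assms(5)[unfolded bernstein_def r] and g = assms(6)[unfolded bernstein_def r]
  have d: "is_Ahx n d" and e: "is_Ahx n e" using f g by simp_all
  note Ahx = assms(3,4) s_Ahx r_Ahx d e
  have exchange: "d * g + ?s f * e = f * e + d * ?s g"
  proof -
    have "(f - ?s f) * e = d * (g - ?s g)" using f g by (simp add: mult.left_commute)
    then show ?thesis by (simp add: algebra_simps)
  qed
  have "f * g - ?s (f * g) = (f - ?s f) * g + ?s f * (g - ?s g)"
    by (simp add: mp_rename_mult algebra_simps)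
  then have "f * g - ?s (f * g) = (mvar (GX i) - mvar (GX (Suc i))) * (d * g + ?s f * e)"
    using f g by (simp add: algebra_simps)
  moreover have "T i * M (f * g) = M (?s (f * g)) * T i + M ?r * M (d * g + ?s f * e)"
    using twisted_leibniz[of "T i" "M f" "M (?s f)" "M ?r" "M d" "M g" "M (?s g)" "M e"]
      f g M_commute[OF r_Ahx s_Ahx(1)]
    by (simp add: mp_rename_mult M_mult M.add Ahx is_Ahx_mult)
  moreover have "T i * M (?s (f * g)) = M (f * g) * T i - M ?r * M (d * g + ?s f * e)"
    using twisted_leibniz[of "T i" "M (?s f)" "M f" "- M ?r" "M d" "M (?s g)" "M g" "M e"]
      f g M_commute[OF r_Ahx assms(3)]
    by (simp add: exchange mp_rename_mult M_mult M.add Ahx is_Ahx_mult add.commute)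
  ultimately show ?thesis
    using Ahx by (simp only: bernstein_def r) (simp add: is_Ahx_add is_Ahx_mult)
qed

lemma ex_bernstein:
  assumes "is_Ahx n f" "1 \<le> i" "i < n"
  shows "\<exists>d. bernstein i f d"
  using assms(1)
proof (induction rule: is_Ahx_induct)
  case (const c)
  show ?case using bernstein_mconst by blast
next
  case (var g)
  then show ?case by (rule bernstein_mvar[OF assms(2,3)])
next
  case (add f g)
  then show ?case using bernstein_add by blast
next
  case (mult f g)
  then show ?case using bernstein_mult[OF assms(2,3)] by blast
qed

lemma Tbar_times_M:
  assumes "is_Ahx n f" "1 \<le> i" "i < n"
  obtains g where "is_Ahx n g" "Tbar i * M f = M (mp_rename (adj i) f) * Tbar i + M g"
proof -
  let ?sf = "mp_rename (adj i) f"
  obtain d where d: "is_Ahx n d" "T i * M f = M ?sf * T i + (h - (p - q) * x i) * M d"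
    using ex_bernstein[OF assms] by (auto simp: bernstein_def)
  define g where
    "g = (mvar Gh - (mvar Gp - mvar Gq) * mvar (GX i)) * d + (mvar Gp - mvar Gq) * (f - ?sf)"
  have sf: "is_Ahx n ?sf" using assms by (simp add: is_Ahx_mp_rename_adj)
  have "M g = (h - (p - q) * x i) * M d + (p - q) * (M f - M ?sf)"
    using assms d sf by (simp add: g_def M_simps is_Ahx_intros)
  then have "Tbar i * M f = M ?sf * Tbar i + M g"
    using p_minus_q_central[of "mp_to_fa ?sf"] d(2)
    by (simp add: Tbar_eq distrib_left distrib_right right_diff_distrib)
  moreover have "is_Ahx n g" unfolding g_def using assms d sf by (intro is_Ahx_intros) auto
  ultimately show thesis using that by blast
qed

lemma double_eq_imp_eq:
  fixes a b :: 'a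
  assumes "a + a = b + b"
  shows "a = b"
proof -
  have "fconst (1/2) + fconst (1/2) = 1" by (simp flip: fconst_add fconst_1)
  then have half: "\<phi> (fconst (1/2)) + \<phi> (fconst (1/2)) = 1" by (metis add one)
  have halve: "\<phi> (fconst (1/2)) * (c + c) = c" for c
    by (simp add: distrib_left half flip: distrib_right)
  show ?thesis using halve[of a] halve[of b] unfolding assms by (rule trans[OF sym])
qed

text \<open>Adding the two forms of the Bernstein relation for a symmetric \<open>f\<close> cancels the divided
  difference.\<close>

lemma Tbar_commutes_symmetric:
  assumes "is_Ahx n f" "1 \<le> i" "i < n" "mp_rename (adj i) f = f"
  shows "Tbar i * M f = M f * Tbar i"
proof -
  obtain d where "T i * M f = M f * T i + (h - (p - q) * x i) * M d"
    "T i * M f = M f * T i - (h - (p - q) * x i) * M d"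
    using ex_bernstein[OF assms(1-3)] assms(4) by (auto simp: bernstein_def)
  then have "T i * M f + T i * M f = M f * T i + M f * T i"
    by (metis add_diff_cancel_left' add_diff_eq diff_add_eq)
  then have "T i * M f = M f * T i" by (rule double_eq_imp_eq)
  then show ?thesis by (simp add: Tbar_eq distrib_left distrib_right p_minus_q_central)
qed

lemma Tbarw_commutes_block_symmetric:
  assumes "v \<in> young n k" "k \<le> n" "is_Ahx n f" "block_symmetric n k f"
  shows "Tbar_perm v * M f = M f * Tbar_perm v"
  using assms(1,2)
proof (induction rule: young_induct)
  case id
  show "Tbar_perm id * M f = M f * Tbar_perm id" by (simp add: Tbarw_id)
next
  case (ascent v i)
  have "mp_rename (adj i) f = f"
    using assms(4) ascent adj_in_young by (auto simp: block_symmetric_def)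
  then have "Tbar i * M f = M f * Tbar i" using Tbar_commutes_symmetric assms(3) ascent by blast
  then have "Tbar_perm v * Tbar i * M f = M f * (Tbar_perm v * Tbar i)"
    using ascent.IH by (metis mult.assoc)
  then show "Tbar_perm (v \<circ> adj i) * M f = M f * Tbar_perm (v \<circ> adj i)"
    using Tbarw_ascent[OF young_imp_Sn] ascent by simp
qed

subsection \<open>Moving polynomials to the left\<close>

definition Tbar_span :: "'a set" where
  "Tbar_span = {\<Sum>u\<in>Sn n. M (c u) * Tbar_perm u | c. \<forall>u. is_Ahx n (c u)}"

lemma Tbar_span_add:
  assumes "y \<in> Tbar_span" "z \<in> Tbar_span"
  shows "y + z \<in> Tbar_span"
proof -
  obtain c d where "\<forall>u. is_Ahx n (c u)" "\<forall>u. is_Ahx n (d u)"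
    "y = (\<Sum>u\<in>Sn n. M (c u) * Tbar_perm u)" "z = (\<Sum>u\<in>Sn n. M (d u) * Tbar_perm u)"
    using assms by (auto simp: Tbar_span_def)
  then show ?thesis
    unfolding Tbar_span_def mem_Collect_eq
    by (intro exI[of _ "\<lambda>u. c u + d u"]) (simp add: M.add sum.distrib distrib_right is_Ahx_add)
qed

lemma M_times_Tbar_perm_in_span:
  assumes "is_Ahx n f" "w \<in> Sn n"
  shows "M f * Tbar_perm w \<in> Tbar_span"
proof -
  have "M f * Tbar_perm w = (\<Sum>u\<in>Sn n. M (if u = w then f else 0) * Tbar_perm u)"
    using assms(2) by (simp add: if_distrib[of "\<lambda>f. M f * _"] M.zero cong: if_cong)
  then show ?thesis
    unfolding Tbar_span_def mem_Collect_eq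
    by (intro exI[of _ "\<lambda>u. if u = w then f else 0"]) (simp add: assms(1) is_Ahx_0)
qed

lemma Tbar_span_sum: "(\<And>a. a \<in> A \<Longrightarrow> F a \<in> Tbar_span) \<Longrightarrow> sum F A \<in> Tbar_span"
  using M_times_Tbar_perm_in_span[OF is_Ahx_0 id_in_Sn]
  by (induction A rule: infinite_finite_induct) (simp_all add: M.zero Tbar_span_add)

lemma Tbar_span_times_Tbar:
  assumes "y \<in> Tbar_span" "1 \<le> i" "i < n"
  shows "y * Tbar i \<in> Tbar_span"
proof -
  obtain c where c: "\<And>u. is_Ahx n (c u)" "y = (\<Sum>u\<in>Sn n. M (c u) * Tbar_perm u)"
    using assms(1) by (auto simp: Tbar_span_def)
  have "M (c u) * Tbar_perm u * Tbar i \<in> Tbar_span" if u: "u \<in> Sn n" for u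
    using u
  proof (cases rule: Sn_ascent_cases[of _ _ i])
    case ascent
    then have "M (c u) * Tbar_perm u * Tbar i = M (c u) * Tbar_perm (u \<circ> adj i)"
      using Tbarw_ascent[OF u assms(2,3)] by (simp add: mult.assoc)
    then show ?thesis using u assms c by (simp add: M_times_Tbar_perm_in_span comp_adj_in_Sn)
  next
    case descent
    have "M (c u) * Tbar_perm u * Tbar i = M (c u * (mvar Gp - mvar Gq)) * Tbar_perm u
      + M (c u * (mvar Gp * mvar Gq)) * Tbar_perm (u \<circ> adj i)"
      using Tbarw_descent[OF u assms(2,3) descent] c(1)
      by (simp add: M_simps is_Ahx_intros distrib_left mult.assoc)
    then show ?thesis
      using u assms c
      by (simp add: Tbar_span_add M_times_Tbar_perm_in_span comp_adj_in_Sn is_Ahx_intros)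
  qed
  then show ?thesis unfolding c(2) sum_distrib_right by (intro Tbar_span_sum)
qed

lemma Tbarw_times_M_in_span:
  assumes "w \<in> Sn n" "is_Ahx n f"
  shows "Tbar_perm w * M f \<in> Tbar_span"
  using assms
proof (induction arbitrary: f rule: Sn_induct)
  case (id f)
  then show "Tbar_perm id * M f \<in> Tbar_span"
    using M_times_Tbar_perm_in_span[OF _ id_in_Sn] by (simp add: Tbarw_id)
next
  case (ascent v i f)
  obtain g where g: "is_Ahx n g" "Tbar i * M f = M (mp_rename (adj i) f) * Tbar i + M g"
    using ascent by (auto elim: Tbar_times_M)
  have "Tbar_perm (v \<circ> adj i) * M f = Tbar_perm v * (Tbar i * M f)"
    using Tbarw_ascent ascent by (simp add: mult.assoc)
  also have "\<dots> = Tbar_perm v * M (mp_rename (adj i) f) * Tbar i + Tbar_perm v * M g"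
    by (simp add: g(2) distrib_left mult.assoc)
  finally show "Tbar_perm (v \<circ> adj i) * M f \<in> Tbar_span"
    using ascent g(1) by (simp add: Tbar_span_add Tbar_span_times_Tbar is_Ahx_mp_rename_adj)
qed

end

subsection \<open>Eigenvectors of the Young subgroup\<close>

definition Tbar_expansion ::
    "nat \<Rightarrow> nat \<Rightarrow> (nat \<Rightarrow> nat) \<Rightarrow> mpoly \<Rightarrow> (nat list \<Rightarrow> (nat \<Rightarrow> nat) \<Rightarrow> mpoly) \<Rightarrow> bool" where
  "Tbar_expansion n k w f c \<longleftrightarrow> (\<forall>lam v. is_Ahx n (c lam v))
    \<and> heq (hrel_central n) (Tbarw n w * mp_to_fa f)
        (\<Sum>lam\<in>parts n k. \<Sum>v\<in>young n k. mp_to_fa (c lam v) * (Tbarw n (wlam n k lam) * Tbarw n v))"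

lemma ex_Tbar_expansion:
  assumes "w \<in> Sn n" "is_Ahx n f" "k \<le> n"
  shows "\<exists>c. Tbar_expansion n k w f c"
proof -
  interpret hecke_hom n "fa_class (hrel_central n)" by (rule hecke_hom_fa_class)
  obtain d where d: "\<And>u. is_Ahx n (d u)" "Tbar_perm w * M f = (\<Sum>u\<in>Sn n. M (d u) * Tbar_perm u)"
    using Tbarw_times_M_in_span[OF assms(1,2)] by (auto simp: Tbar_span_def)
  let ?c = "\<lambda>lam v. d (wlam n k lam \<circ> v)"
  have "Tbar_perm w * M f
    = (\<Sum>(lam, v)\<in>parts n k \<times> young n k. M (?c lam v) * Tbar_perm (wlam n k lam \<circ> v))"
    unfolding d(2)
    by (subst sum.reindex_bij_betw[OF wlam_factorization_bij[OF assms(3)], symmetric])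
      (simp add: case_prod_unfold)
  also have "\<dots> = (\<Sum>lam\<in>parts n k. \<Sum>v\<in>young n k.
      M (?c lam v) * (Tbar_perm (wlam n k lam) * Tbar_perm v))"
    using assms(3) wlam_in_grassmannian
    by (simp add: Tbarw_grassmannian_comp_young sum.cartesian_product[symmetric])
  finally have "fa_class (hrel_central n) (Tbarw n w * mp_to_fa f) = fa_class (hrel_central n)
    (\<Sum>lam\<in>parts n k. \<Sum>v\<in>young n k. mp_to_fa (?c lam v) * (Tbarw n (wlam n k lam) * Tbarw n v))"
    by (simp add: hom_simps)
  then have "Tbar_expansion n k w f ?c"
    using d(1) by (simp add: Tbar_expansion_def fa_class_eq_iff augmented_hrel_central)
  then show ?thesis by blast
qed

text \<open>The image of \<open>\<Sum>\<^sub>v c\<^sub>v \<T>\<^sub>v\<close> under the character \<open>\<T>\<^sub>v \<mapsto> p\<^bsup>\<ell>(v)\<^esup>\<close>.\<close>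

definition young_character :: "nat \<Rightarrow> nat \<Rightarrow> ((nat \<Rightarrow> nat) \<Rightarrow> mpoly) \<Rightarrow> mpoly" where
  "young_character n k c = (\<Sum>v\<in>young n k. c v * mvar Gp ^ plen n v)"

lemma is_Ahx_young_character: "(\<And>v. is_Ahx n (c v)) \<Longrightarrow> is_Ahx n (young_character n k c)"
  unfolding young_character_def by (intro is_Ahx_intros) auto

lemma (in hecke_hom) M_young_character:
  "(\<And>v. is_Ahx n (c v)) \<Longrightarrow> M (young_character n k c) = (\<Sum>v\<in>young n k. M (c v) * p ^ plen n v)"
  by (simp add: young_character_def M.sum M_mult M_power M_mvar is_Ahx_intros)

locale hecke_module =
  fixes n :: nat and act :: "fa \<Rightarrow> 'm::ab_group_add \<Rightarrow> 'm"
  assumes additive_left: "additive (\<lambda>a. act a y)"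
    and additive_right: "additive (act a)"
    and act_times: "act (a * b) y = act a (act b y)"
    and act_one: "act 1 y = y"
    and act_relation: "r \<in> hrel_central n \<Longrightarrow> act r y = 0"
begin

sublocale left: additive "\<lambda>a. act a y" for y
  by (rule additive_left)

sublocale right: additive "act a" for a
  by (rule additive_right)

sublocale hecke: hecke_hom n "fa_class (hrel_central n)"
  by (rule hecke_hom_fa_class)

lemma act_fideal: "a \<in> fideal (hrel_central n) \<Longrightarrow> act a y = 0"
  by (induction arbitrary: y rule: fideal.induct)
    (simp_all add: fmul_eq_times act_times act_relation left.add left.zero right.zero)

lemma act_heq: "heq (hrel_central n) a b \<Longrightarrow> act a y = act b y"
  using act_fideal[of "a - b" y] by (simp add: heq_def left.diff)

lemma act_cong: "fa_class (hrel_central n) a = fa_class (hrel_central n) b \<Longrightarrow> act a y = act b y"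
  by (simp add: act_heq fa_class_eq_iff augmented_hrel_central)

lemma act_commute:
  assumes "fa_class (hrel_central n) a * fa_class (hrel_central n) b
    = fa_class (hrel_central n) b * fa_class (hrel_central n) a"
  shows "act a (act b y) = act b (act a y)"
  using act_cong[of "a * b" "b * a" y] assms by (simp add: hecke.mult act_times)

lemma act_p_power_commute: "act a (act (fgen Gp ^ j) y) = act (fgen Gp ^ j) (act a y)"
  by (rule act_commute) (simp add: hecke.power hecke.p_power_central)

lemma act_Tbarw_id: "act (Tbarw n id) y = y"
  using act_cong[of "Tbarw n id" 1 y] by (simp add: hecke.Tbarw_id hecke.one act_one)

lemma act_Tbarw_ascent:
  assumes "w \<in> Sn n" "1 \<le> i" "i < n" "w i < w (Suc i)"
  shows "act (Tbarw n (w \<circ> adj i)) y = act (Tbarw n w) (act (Tbar_i i) y)"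
proof -
  have "act (Tbarw n (w \<circ> adj i)) y = act (Tbarw n w * Tbar_i i) y"
    by (rule act_cong) (simp only: hecke.Tbarw_ascent[OF assms] hecke.mult)
  then show ?thesis by (simp only: act_times)
qed

lemma act_Tbarw_grassmannian_comp_young:
  assumes "v \<in> young n k" "k \<le> n" "w \<in> grassmannian n k"
  shows "act (Tbarw n (w \<circ> v)) y = act (Tbarw n w) (act (Tbarw n v) y)"
proof -
  have "act (Tbarw n (w \<circ> v)) y = act (Tbarw n w * Tbarw n v) y"
    by (rule act_cong) (simp only: hecke.Tbarw_grassmannian_comp_young[OF assms] hecke.mult)
  then show ?thesis by (simp only: act_times)
qed

definition young_eigenvector :: "nat \<Rightarrow> 'm \<Rightarrow> bool" where
  "young_eigenvector k z \<longleftrightarrow> (\<forall>v\<in>young n k. act (Tbarw n v) z = act (fgen Gp ^ plen n v) z)"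

lemma young_eigenvectorI:
  assumes "k \<le> n" "\<And>i. 1 \<le> i \<Longrightarrow> i < n \<Longrightarrow> i \<noteq> k \<Longrightarrow> act (Tbar_i i) z = act (fgen Gp) z"
  shows "young_eigenvector k z"
  unfolding young_eigenvector_def
proof
  fix v assume "v \<in> young n k"
  then show "act (Tbarw n v) z = act (fgen Gp ^ plen n v) z"
    using assms(1)
  proof (induction rule: young_induct)
    case id
    show "act (Tbarw n id) z = act (fgen Gp ^ plen n id) z" by (simp add: act_Tbarw_id act_one)
  next
    case (ascent v i)
    have "act (Tbarw n (v \<circ> adj i)) z = act (Tbarw n v) (act (fgen Gp ^ 1) z)"
      using ascent assms(2) by (simp add: act_Tbarw_ascent young_imp_Sn)
    also have "\<dots> = act (fgen Gp ^ 1) (act (Tbarw n v) z)" by (rule act_p_power_commute)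
    also have "\<dots> = act (fgen Gp ^ 1) (act (fgen Gp ^ plen n v) z)" by (simp only: ascent.IH)
    also have "\<dots> = act (fgen Gp ^ plen n (v \<circ> adj i)) z"
      using ascent by (simp add: plen_comp_adj_ascent act_times)
    finally show "act (Tbarw n (v \<circ> adj i)) z = act (fgen Gp ^ plen n (v \<circ> adj i)) z" .
  qed
qed

text \<open>By the quadratic relation, \<open>T\<^sub>i + p\<close> maps into the \<open>p\<close>-eigenspace of \<open>Tbar_i i\<close>.\<close>

lemma act_Tbar_i_sum_involution:
  assumes "1 \<le> i" "i < n"
    and involution: "\<And>a. a \<in> A \<Longrightarrow> s a \<in> A" "\<And>a. a \<in> A \<Longrightarrow> s (s a) = a"
    and swap: "\<And>a. a \<in> A \<Longrightarrow> Q (s a) \<longleftrightarrow> \<not> Q a"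
    and pair: "\<And>a. a \<in> A \<Longrightarrow> Q a \<Longrightarrow> \<exists>y. F (s a) + F a = act (fgen (GT i) + fgen Gp) y"
  shows "act (Tbar_i i) (sum F A) = act (fgen Gp) (sum F A)"
proof -
  have eigen: "act (Tbar_i i) (act (fgen (GT i) + fgen Gp) y)
    = act (fgen Gp) (act (fgen (GT i) + fgen Gp) y)" for y
    using act_cong[of "Tbar_i i * (fgen (GT i) + fgen Gp)" "fgen Gp * (fgen (GT i) + fgen Gp)" y]
      hecke.Tbar_T_plus_p[OF assms(1,2)]
    by (simp add: hecke.mult hecke.add act_times)
  define D where "D a = act (Tbar_i i) (F a) - act (fgen Gp) (F a)" for a
  have "D (s a) + D a = 0" if "a \<in> A" for a
  proof -
    have "D (s a) + D a = act (Tbar_i i) (F (s a) + F a) - act (fgen Gp) (F (s a) + F a)"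
      by (simp add: D_def right.add)
    moreover have "\<exists>y. F (s a) + F a = act (fgen (GT i) + fgen Gp) y"
      using pair[OF that] pair[OF involution(1)[OF that]] swap[OF that] involution(2)[OF that]
      by (cases "Q a") (auto simp: add.commute)
    ultimately show ?thesis using eigen by auto
  qed
  moreover have "s a \<noteq> a" if "a \<in> A" for a using swap[OF that] by auto
  ultimately have "sum D A = 0" using involution by (intro sum_involution_eq_0[of A D s])
  then show ?thesis by (simp add: D_def sum_subtractf right.sum)
qed

lemma young_eigenvector_act_block_symmetric:
  assumes "young_eigenvector k z" "k \<le> n" "is_Ahx n f" "block_symmetric n k f"
  shows "young_eigenvector k (act (mp_to_fa f) z)"
  unfolding young_eigenvector_def
proof
  fix v assume v: "v \<in> young n k"
  have "act (Tbarw n v) (act (mp_to_fa f) z) = act (mp_to_fa f) (act (Tbarw n v) z)"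
    by (rule act_commute) (rule hecke.Tbarw_commutes_block_symmetric[OF v assms(2-4)])
  then show "act (Tbarw n v) (act (mp_to_fa f) z) = act (fgen Gp ^ plen n v) (act (mp_to_fa f) z)"
    using assms(1) v by (simp add: young_eigenvector_def act_p_power_commute)
qed

lemma act_Tbar_expansion:
  assumes "young_eigenvector k z" "Tbar_expansion n k w f c"
  shows "act (Tbarw n w) (act (mp_to_fa f) z)
    = (\<Sum>lam\<in>parts n k.
        act (mp_to_fa (young_character n k (c lam))) (act (Tbarw n (wlam n k lam)) z))"
proof -
  have c: "is_Ahx n (c lam v)" for lam v using assms(2) by (simp add: Tbar_expansion_def)
  have contract: "act (mp_to_fa (young_character n k (c lam))) y
    = (\<Sum>v\<in>young n k. act (mp_to_fa (c lam v)) (act (fgen Gp ^ plen n v) y))" for lam y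
    using act_cong[of "mp_to_fa (young_character n k (c lam))"
        "\<Sum>v\<in>young n k. mp_to_fa (c lam v) * fgen Gp ^ plen n v" y]
    by (simp add: hecke.M_young_character[OF c] hecke.hom_simps left.sum act_times)
  have "act (Tbarw n w) (act (mp_to_fa f) z) = act (\<Sum>lam\<in>parts n k. \<Sum>v\<in>young n k.
      mp_to_fa (c lam v) * (Tbarw n (wlam n k lam) * Tbarw n v)) z"
    using assms(2) by (simp add: Tbar_expansion_def act_heq flip: act_times)
  also have "\<dots> = (\<Sum>lam\<in>parts n k. \<Sum>v\<in>young n k.
      act (mp_to_fa (c lam v)) (act (Tbarw n (wlam n k lam)) (act (fgen Gp ^ plen n v) z)))"
    using assms(1) by (simp add: left.sum act_times young_eigenvector_def)
  finally show ?thesis by (simp add: contract act_p_power_commute)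
qed

end

subsection \<open>The parabolic symmetrizer\<close>

context hecke_hom
begin

lemma hecke_module_regular: "hecke_module n (\<lambda>a y. \<phi> a * y)"
  by standard (simp_all add: add mult one relation distrib_left distrib_right mult.assoc)

lemma Sigma_nk_eq:
  "\<phi> (Sigma_nk n k) = (\<Sum>v\<in>young n k. G Gc * (q ^ (dkn n k - plen n v) * Tbar_perm v))"
  by (simp add: Sigma_nk_def fa_ring_simps hom_simps sum_distrib_left)

lemma Sigma_nk_commutes_block_symmetric:
  assumes "k \<le> n" "is_Ahx n f" "block_symmetric n k f"
  shows "\<phi> (Sigma_nk n k) * M f = M f * \<phi> (Sigma_nk n k)"
proof -
  have "G Gc * (q ^ j * Tbar_perm v) * M f = M f * (G Gc * (q ^ j * Tbar_perm v))"
    if "v \<in> young n k" for v j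
    using Tbarw_commutes_block_symmetric[OF that assms] q_power_central[of j "mp_to_fa f"]
      scalar_central[of Gc "mp_to_fa f"]
    by (metis mult.assoc)
  then show ?thesis by (simp add: Sigma_nk_eq sum_distrib_left sum_distrib_right)
qed

lemma Sigma_nk_pair:
  assumes "v \<in> young n k" "k \<le> n" "1 \<le> i" "i < n" "i \<noteq> k" "inv v i < inv v (Suc i)"
  shows "G Gc * (q ^ (dkn n k - plen n (adj i \<circ> v)) * Tbar_perm (adj i \<circ> v))
      + G Gc * (q ^ (dkn n k - plen n v) * Tbar_perm v)
    = \<phi> (fgen (GT i) + fgen Gp) * (G Gc * (q ^ (dkn n k - plen n (adj i \<circ> v)) * Tbar_perm v))"
proof -
  let ?e = "q ^ (dkn n k - plen n (adj i \<circ> v))" and ?Tp = "fgen (GT i) + fgen Gp"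
  have v: "v \<in> Sn n" using assms(1) by (rule young_imp_Sn)
  have "plen n (adj i \<circ> v) \<le> dkn n k"
    using assms by (intro plen_young_le_dkn comp_in_young adj_in_young)
  then have "dkn n k - plen n v = Suc (dkn n k - plen n (adj i \<circ> v))"
    using plen_left_ascent[OF v assms(3,4,6)] by simp
  then have "q ^ (dkn n k - plen n v) = ?e * q" by (simp add: power_commutes)
  moreover have "Tbar_perm (adj i \<circ> v) = Tbar i * Tbar_perm v"
    using v assms by (simp add: Tbarw_eq_wprod Tbar.wprod_left_ascent)
  ultimately have "G Gc * (?e * Tbar_perm (adj i \<circ> v))
      + G Gc * (q ^ (dkn n k - plen n v) * Tbar_perm v)
    = G Gc * (?e * (Tbar i + q) * Tbar_perm v)"
    by (simp add: distrib_left distrib_right mult.assoc)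
  also have "Tbar i + q = \<phi> ?Tp" by (simp add: Tbar_eq add)
  also have "?e * \<phi> ?Tp = \<phi> ?Tp * ?e" by (rule q_power_central)
  also have "G Gc * (\<phi> ?Tp * ?e * Tbar_perm v) = G Gc * \<phi> ?Tp * (?e * Tbar_perm v)"
    by (simp only: mult.assoc)
  also have "G Gc * \<phi> ?Tp = \<phi> ?Tp * G Gc" by (rule scalar_central) simp
  finally show ?thesis by (simp only: mult.assoc)
qed

lemma young_eigenvector_Sigma_nk:
  assumes "k \<le> n"
  shows "hecke_module.young_eigenvector n (\<lambda>a y. \<phi> a * y) k (\<phi> (Sigma_nk n k))"
proof -
  interpret regular: hecke_module n "\<lambda>a y. \<phi> a * y" by (rule hecke_module_regular)
  show ?thesis
  proof (rule regular.young_eigenvectorI[OF assms])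
    fix i assume i: "1 \<le> i" "i < n" "i \<noteq> k"
    show "Tbar i * \<phi> (Sigma_nk n k) = p * \<phi> (Sigma_nk n k)"
      unfolding Sigma_nk_eq
    proof (rule regular.act_Tbar_i_sum_involution[OF i(1,2)])
      fix v assume v: "v \<in> young n k"
      show "adj i \<circ> v \<in> young n k" using v i by (intro comp_in_young adj_in_young)
      show "adj i \<circ> (adj i \<circ> v) = v" by simp
      have "inv (adj i \<circ> v) = inv v \<circ> adj i"
        using bij_Sn[OF young_imp_Sn[OF v]] by (simp add: o_inv_distrib)
      moreover have "inv v \<in> Sn n" using v by (intro inv_in_Sn young_imp_Sn)
      ultimately show "inv (adj i \<circ> v) i < inv (adj i \<circ> v) (Suc i) \<longleftrightarrow> \<not> inv v i < inv v (Suc i)"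
        by (auto elim: Sn_ascent_cases[of _ _ i])
      assume "inv v i < inv v (Suc i)"
      from Sigma_nk_pair[OF v assms i this]
      show "\<exists>y. G Gc * (q ^ (dkn n k - plen n (adj i \<circ> v)) * Tbar_perm (adj i \<circ> v))
        + G Gc * (q ^ (dkn n k - plen n v) * Tbar_perm v) = \<phi> (fgen (GT i) + fgen Gp) * y" ..
    qed
  qed
qed

lemma Tbar_lam_times_block_symmetric:
  assumes "k \<le> n" "is_Ahx n f" "block_symmetric n k f" "Tbar_expansion n k (wlam n k mu) f c"
  shows "\<phi> (Tbar_lam n k mu) * M f
    = (\<Sum>lam\<in>parts n k. M (young_character n k (c lam)) * \<phi> (Tbar_lam n k lam))"
proof -
  interpret regular: hecke_module n "\<lambda>a y. \<phi> a * y" by (rule hecke_module_regular)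
  have "\<phi> (Tbar_lam n k mu) * M f = Tbar_perm (wlam n k mu) * (M f * \<phi> (Sigma_nk n k))"
    by (simp add: Tbar_lam_def fmul_eq_times mult mult.assoc
        Sigma_nk_commutes_block_symmetric[OF assms(1-3)])
  also have "\<dots> = (\<Sum>lam\<in>parts n k.
      M (young_character n k (c lam)) * (Tbar_perm (wlam n k lam) * \<phi> (Sigma_nk n k)))"
    by (rule regular.act_Tbar_expansion[OF young_eigenvector_Sigma_nk[OF assms(1)] assms(4)])
  finally show ?thesis by (simp add: Tbar_lam_def fmul_eq_times mult)
qed

end

lemma heq_Tbar_lam_times_block_symmetric:
  assumes "k \<le> n" "is_Ahx n f" "block_symmetric n k f" "Tbar_expansion n k (wlam n k mu) f c"
  shows "heq (hrel_loc n k) (fmul (Tbar_lam n k mu) (mp_to_fa f))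
    (\<Sum>lam\<in>parts n k. fmul (mp_to_fa (young_character n k (c lam))) (Tbar_lam n k lam))"
proof -
  interpret hecke_hom n "fa_class (hrel_central n)" by (rule hecke_hom_fa_class)
  have "fa_class (hrel_central n) (Tbar_lam n k mu * mp_to_fa f) = fa_class (hrel_central n)
    (\<Sum>lam\<in>parts n k. mp_to_fa (young_character n k (c lam)) * Tbar_lam n k lam)"
    using Tbar_lam_times_block_symmetric[OF assms] by (simp add: hom_simps)
  then have "heq (hrel_central n) (Tbar_lam n k mu * mp_to_fa f)
    (\<Sum>lam\<in>parts n k. mp_to_fa (young_character n k (c lam)) * Tbar_lam n k lam)"
    by (simp only: fa_class_eq_iff augmented_hrel_central)
  then show ?thesis
    unfolding fmul_eq_times by (rule heq_mono[OF hrel_central_subset_hrel_loc])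
qed

subsection \<open>Schubert representations\<close>

lemma w0_in_Sn: "w0 n \<in> Sn n"
proof -
  have "bij_betw (w0 n) {1..n} {1..n}"
    by (rule bij_betw_byWitness[where f' = "w0 n"]) (auto simp: w0_def)
  then show ?thesis by (auto simp: Sn_def w0_def intro: bij_imp_permutes)
qed

lemma inv_w0: "inv (w0 n) = w0 n"
  by (rule inv_equality) (auto simp: w0_def)

locale schubert =
  fixes n :: nat and scale :: "'f::field_char_0 \<Rightarrow> 'v::ab_group_add \<Rightarrow> 'v" and pF qF hF :: 'f
    and t :: "nat \<Rightarrow> 'f" and Top Xop :: "nat \<Rightarrow> 'v \<Rightarrow> 'v" and Y :: "(nat \<Rightarrow> nat) \<Rightarrow> 'v"
    and ev :: "'v \<Rightarrow> 'f"
  assumes rep: "schubert_rep n scale pF qF hF t Top Xop Y ev"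
begin

sublocale vector_space scale
  using rep by (simp add: schubert_rep_def)

sublocale ev: Vector_Spaces.linear scale "(*)" ev
  using rep by (simp add: schubert_rep_def)

abbreviation gact :: "gen \<Rightarrow> 'v \<Rightarrow> 'v" where "gact \<equiv> gen_act n scale pF qF hF Top Xop"
abbreviation act :: "fa \<Rightarrow> 'v \<Rightarrow> 'v" where "act \<equiv> vact n scale pF qF hF Top Xop"
abbreviation val :: "gen \<Rightarrow> 'f" where "val \<equiv> eval_val pF qF hF t"

definition wact :: "gen list \<Rightarrow> 'v \<Rightarrow> 'v" where
  "wact u = foldr (\<lambda>g h. gact g \<circ> h) u id"

lemma wact_Nil [simp]: "wact [] y = y"
  by (simp add: wact_def)

lemma wact_Cons [simp]: "wact (g # u) y = gact g (wact u y)"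
  by (simp add: wact_def)

lemma wact_append: "wact (u @ w) y = wact u (wact w y)"
  by (induction u) simp_all

lemma gact_linear: "Vector_Spaces.linear scale scale (gact g)"
proof (cases g)
  case (GT i)
  then show ?thesis
    using rep
    by (cases "1 \<le> i \<and> i < n") (auto simp: gen_act_def schubert_rep_def Vector_Spaces.linear_iff)
next
  case (GX i)
  then show ?thesis
    using rep
    by (cases "1 \<le> i \<and> i \<le> n") (auto simp: gen_act_def schubert_rep_def Vector_Spaces.linear_iff)
qed (auto simp: gen_act_def Vector_Spaces.linear_iff vector_space_axioms scale_right_distrib
    mult.commute)

lemma gact_add: "gact g (y + z) = gact g y + gact g z"
  and gact_scale: "gact g (scale c y) = scale c (gact g y)"
  using gact_linear[of g] by (simp_all add: Vector_Spaces.linear_iff)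

lemma wact_add: "wact u (y + z) = wact u y + wact u z"
  by (induction u) (simp_all add: gact_add)

lemma wact_scale: "wact u (scale c y) = scale c (wact u y)"
  by (induction u) (simp_all add: gact_scale)

lemma act_eq:
  "act a y = (\<Sum>u\<in>Poly_Mapping.keys a. scale (of_rat (Poly_Mapping.lookup a u)) (wact u y))"
  by (simp add: vact_def wact_def)

lemma act_scale: "act a (scale c y) = scale c (act a y)"
  by (simp add: act_eq wact_scale scale_sum_right mult.commute)

lemma act_single: "act (Poly_Mapping.single u c) y = scale (of_rat c) (wact u y)"
  by (cases "c = 0") (simp_all add: act_eq)

lemma act_fgen: "act (fgen g) y = gact g y"
  by (simp add: fgen_def act_single)

lemma act_plus: "act (a + b) y = act a y + act b y"
  unfolding act_eq by (rule setsum_keys_plus_distrib) (simp_all add: of_rat_add scale_left_distrib)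

lemma act_add: "act a (y + z) = act a y + act a z"
  by (simp add: act_eq wact_add scale_right_distrib sum.distrib)

lemma act_mult: "act (a * b) y = act a (act b y)"
proof (induction a rule: poly_mapping_single_induct)
  case (single u c)
  show ?case
    by (induction b rule: poly_mapping_single_induct)
      (simp_all add: mult_single plus_list_def act_single wact_append wact_scale of_rat_mult
        distrib_left act_plus wact_add scale_right_distrib)
qed (simp add: distrib_right act_plus)

lemma act_hrel_central:
  assumes "r \<in> hrel_central n"
  shows "act r y = 0"
proof (cases "r \<in> hrel n")
  case True
  then show ?thesis using rep unfolding schubert_rep_def by blast
next
  case False
  then obtain g where "r = fgen Gc * fgen g - fgen g * fgen Gc"
    using assms by (auto simp: hrel_central_def fcomm_eq)
  then have "r + fgen g * fgen Gc = fgen Gc * fgen g" by simp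
  then have "act r y + act (fgen g * fgen Gc) y = act (fgen Gc * fgen g) y" by (metis act_plus)
  moreover have "gact g 0 = 0" using gact_scale[of g 0 0] by simp
  ultimately show ?thesis by (simp add: act_mult act_fgen gen_act_def[of _ _ _ _ _ _ _ Gc])
qed

sublocale hecke_module n act
proof
  show "act 1 y = y" for y
    by (simp add: act_single fconst_def flip: fconst_1)
qed (simp_all add: act_plus act_add act_mult act_hrel_central)

lemma act_p: "act (fgen Gp) y = scale pF y" and act_q: "act (fgen Gq) y = scale qF y"
  by (simp_all add: act_fgen gen_act_def)

lemma act_p_power: "act (fgen Gp ^ j) y = scale (pF ^ j) y"
  by (induction j) (simp_all add: act_one act_times act_p mult.commute)

lemma ev_Y: "w \<in> Sn n \<Longrightarrow> ev (Y w) \<noteq> 0 \<longleftrightarrow> w = id"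
  and span_Y: "span (Y ` Sn n) = UNIV"
  and inj_Y: "inj_on Y (Sn n)"
  and Y_eq: "w \<in> Sn n \<Longrightarrow> Y w = act (Tw n (inv w \<circ> w0 n)) (Y (w0 n))"
  and ev_Xop_Y: "w \<in> Sn n \<Longrightarrow> 1 \<le> i \<Longrightarrow> i \<le> n \<Longrightarrow> ev (Xop i (Y w)) = t i * ev (Y w)"
  using rep unfolding schubert_rep_def by blast+

lemma ev_Y_id: "ev (Y id) \<noteq> 0"
  by (simp add: ev_Y)

lemma ev_gact:
  assumes "g \<in> poly_gens n"
  shows "ev (gact g y) = val g * ev y"
proof -
  have "y \<in> span (Y ` Sn n)" by (simp add: span_Y)
  then show ?thesis
  proof (induction rule: span_induct_alt)
    case base
    show ?case using gact_scale[of g 0 0] by simp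
  next
    case (step c z y)
    then have "ev (gact g z) = val g * ev z"
      using assms ev_Xop_Y
      by (auto simp: poly_gens_def scal_gen_def gen_act_def eval_val_def ev.scale)
    then show ?case
      using step.IH
      by (simp add: gact_add gact_scale ev.add ev.scale distrib_left mult.left_commute)
  qed
qed

lemma ev_wact: "set u \<subseteq> poly_gens n \<Longrightarrow> ev (wact u y) = prod_list (map val u) * ev y"
  by (induction u) (simp_all add: ev_gact)

lemma ev_act_mp_to_fa:
  assumes "is_Ahx n f"
  shows "ev (act (mp_to_fa f) y) = mp_eval val f * ev y"
proof -
  have monomial: "ev (wact (mono_word m) y)
      = (\<Prod>g\<in>Poly_Mapping.keys m. val g ^ Poly_Mapping.lookup m g) * ev y"
    if "m \<in> Poly_Mapping.keys f" for m
  proof -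
    have "prod_list (map val (mono_word m)) = prod_mset (image_mset val (mset (mono_word m)))"
      by (simp add: prod_mset_prod_list flip: mset_map)
    also have "\<dots> = (\<Prod>g\<in>Poly_Mapping.keys m. val g ^ Poly_Mapping.lookup m g)"
      by (simp add: image_prod_mset_multiplicity count_mono_word set_mono_word)
    finally show ?thesis using assms that by (simp add: ev_wact set_mono_word is_Ahx_iff)
  qed
  have "ev (act (mp_to_fa f) y)
    = (\<Sum>m\<in>Poly_Mapping.keys f. of_rat (Poly_Mapping.lookup f m) * ev (wact (mono_word m) y))"
    by (simp add: mp_to_fa_def left.sum act_single ev.sum ev.scale)
  also have "\<dots> = mp_eval val f * ev y"
    unfolding mp_eval_def sum_distrib_right by (intro sum.cong) (simp_all only: monomial mult.assoc)
  finally show ?thesis .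
qed

lemma act_T_descent:
  assumes "w \<in> Sn n" "1 \<le> i" "i < n" "w (Suc i) < w i"
  shows "act (fgen (GT i)) (Y w) = Y (w \<circ> adj i)"
proof -
  let ?u = "inv w \<circ> w0 n"
  have u: "?u \<in> Sn n" using assms by (intro comp_in_Sn inv_in_Sn w0_in_Sn)
  have bij: "bij w" "bij (w0 n)" using assms(1) w0_in_Sn bij_Sn by auto
  then have inv_u: "inv ?u = w0 n \<circ> w"
    by (simp add: o_inv_distrib bij_imp_bij_inv inv_inv_eq inv_w0)
  have "w i \<in> {1..n}" "w (Suc i) \<in> {1..n}"
    using assms Sn_image[OF assms(1)] imageI[of _ "{1..n}" w] by auto
  then have "inv ?u i < inv ?u (Suc i)" unfolding inv_u using assms(4) by (simp add: w0_def)
  then have "act (Tw n (adj i \<circ> ?u)) (Y (w0 n)) = act (fgen (GT i) * Tw n ?u) (Y (w0 n))"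
    using hecke.T.wprod_left_ascent[OF u assms(2,3)]
    by (intro act_cong) (simp add: hecke.Tw_eq_wprod hecke.mult)
  moreover have "inv (w \<circ> adj i) \<circ> w0 n = adj i \<circ> ?u"
    using bij by (simp add: o_inv_distrib comp_assoc)
  ultimately show ?thesis
    using Y_eq[OF assms(1)] Y_eq[OF comp_adj_in_Sn[OF assms(1-3)]] by (simp add: act_times)
qed

lemma act_Tbar_descent:
  assumes "w \<in> Sn n" "1 \<le> i" "i < n" "w (Suc i) < w i"
  shows "act (Tbar_i i) (Y w) = Y (w \<circ> adj i) + scale (pF - qF) (Y w)"
  using act_T_descent[OF assms]
  by (simp add: Tbar_i_def left.diff left.add act_p act_q scale_left_diff_distrib)

lemma act_Tbar_ascent:
  assumes "w \<in> Sn n" "1 \<le> i" "i < n" "w i < w (Suc i)"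
  shows "act (Tbar_i i) (Y w) = scale (pF * qF) (Y (w \<circ> adj i))"
proof -
  have "act (fgen (GT i)) (Y (w \<circ> adj i)) = Y (w \<circ> adj i \<circ> adj i)"
    using assms by (intro act_T_descent comp_adj_in_Sn) auto
  then have "act (Tbar_i i) (Y w) = act (Tbar_i i * fgen (GT i)) (Y (w \<circ> adj i))"
    by (simp add: act_times)
  also have "\<dots> = act (fgen Gp * fgen Gq) (Y (w \<circ> adj i))"
    by (rule act_cong) (simp add: hecke.mult hecke.Tbar_T[OF assms(2,3)])
  finally show ?thesis by (simp add: act_times act_p act_q)
qed

lemma ev_Tbarw_Y:
  assumes "w \<in> Sn n" "u \<in> Sn n"
  shows "ev (act (Tbarw n w) (Y u)) = (if u = w then ev (Y id) else 0)"
  using assms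
proof (induction arbitrary: u rule: Sn_induct)
  case (id u)
  show "ev (act (Tbarw n id) (Y u)) = (if u = id then ev (Y id) else 0)"
    using ev_Y[OF id] by (auto simp: act_Tbarw_id)
next
  case (ascent v i u)
  have us: "u \<circ> adj i \<in> Sn n" using ascent by (intro comp_adj_in_Sn)
  have iff: "u \<circ> adj i = v \<longleftrightarrow> u = v \<circ> adj i" by (metis comp_adj_adj)
  have IH: "ev (act (Tbarw n v) (Y (u \<circ> adj i))) = (if u \<circ> adj i = v then ev (Y id) else 0)"
    by (rule ascent.IH[OF us])
  have step: "act (Tbarw n (v \<circ> adj i)) (Y u) = act (Tbarw n v) (act (Tbar_i i) (Y u))"
    using ascent by (intro act_Tbarw_ascent)
  show "ev (act (Tbarw n (v \<circ> adj i)) (Y u)) = (if u = v \<circ> adj i then ev (Y id) else 0)"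
    using ascent.prems
  proof (cases rule: Sn_ascent_cases[of _ _ i])
    case ascent: ascent
    then have "u \<noteq> v \<circ> adj i" using \<open>v i < v (Suc i)\<close> by auto
    then show ?thesis
      using act_Tbar_ascent[OF \<open>u \<in> Sn n\<close> _ _ ascent] ascent.hyps IH iff
      by (simp add: step act_scale ev.scale)
  next
    case descent
    then have "u \<noteq> v" using ascent by auto
    then show ?thesis
      using act_Tbar_descent[OF ascent.prems _ _ descent] ascent.hyps IH ascent.IH[OF ascent.prems] iff
      by (simp add: step act_scale right.add ev.add ev.scale)
  qed
qed

lemma eqI_ev_Tbarw:
  assumes "\<And>w. w \<in> Sn n \<Longrightarrow> ev (act (Tbarw n w) y) = ev (act (Tbarw n w) z)"
  shows "y = z"
proof -
  have "y - z \<in> span (Y ` Sn n)" by (simp add: span_Y)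
  then obtain c where "y - z = (\<Sum>b\<in>Y ` Sn n. scale (c b) b)" by (auto simp: span_finite)
  also have "\<dots> = (\<Sum>u\<in>Sn n. scale (c (Y u)) (Y u))" using inj_Y by (simp add: sum.reindex)
  finally have coordinates: "y - z = (\<Sum>u\<in>Sn n. scale (c (Y u)) (Y u))" .
  have "c (Y w) = 0" if w: "w \<in> Sn n" for w
  proof -
    have "0 = ev (act (Tbarw n w) (y - z))" using assms[OF w] by (simp add: right.diff ev.diff)
    also have "\<dots> = (\<Sum>u\<in>Sn n. c (Y u) * (if u = w then ev (Y id) else 0))"
      using w by (simp add: coordinates right.sum act_scale ev.sum ev.scale ev_Tbarw_Y)
    also have "\<dots> = c (Y w) * ev (Y id)" using w by (simp add: if_distrib cong: if_cong)
    finally show ?thesis using ev_Y_id by simp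
  qed
  then show ?thesis using coordinates by simp
qed

lemma young_eigenvector_eqI:
  assumes "young_eigenvector k y" "young_eigenvector k z" "k \<le> n"
    and "\<And>mu. mu \<in> parts n k \<Longrightarrow> ev (act (Tbarw n (wlam n k mu)) y) = ev (act (Tbarw n (wlam n k mu)) z)"
  shows "y = z"
proof (rule eqI_ev_Tbarw)
  fix w assume "w \<in> Sn n"
  then obtain mu v where mu: "mu \<in> parts n k" and v: "v \<in> young n k" and w: "w = wlam n k mu \<circ> v"
    using wlam_factorization assms(3) by blast
  have "ev (act (Tbarw n w) x) = pF ^ plen n v * ev (act (Tbarw n (wlam n k mu)) x)"
    if "young_eigenvector k x" for x
    using that v mu assms(3)
    by (simp add: w act_Tbarw_grassmannian_comp_young wlam_in_grassmannian young_eigenvector_def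
        act_p_power act_scale ev.scale)
  then show "ev (act (Tbarw n w) y) = ev (act (Tbarw n w) z)"
    using assms(1,2) assms(4)[OF mu] by simp
qed

lemma young_eigenvector_linear_combination:
  assumes "\<And>a. a \<in> A \<Longrightarrow> young_eigenvector k (F a)"
  shows "young_eigenvector k (\<Sum>a\<in>A. scale (c a) (F a))"
  using assms by (simp add: young_eigenvector_def right.sum act_scale)

abbreviation Yl :: "nat \<Rightarrow> nat list \<Rightarrow> 'v" where "Yl k \<equiv> Y_lam n k scale pF Y"

lemma Y_lam_pair:
  assumes "lam \<in> parts n k" "v \<in> young n k" "k \<le> n" "1 \<le> i" "i < n" "i \<noteq> k" "v i < v (Suc i)"
  shows "scale (pF ^ plen n (v \<circ> adj i)) (Y (wlam n k lam \<circ> (v \<circ> adj i)))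
      + scale (pF ^ plen n v) (Y (wlam n k lam \<circ> v))
    = act (fgen (GT i) + fgen Gp) (scale (pF ^ plen n v) (Y (wlam n k lam \<circ> (v \<circ> adj i))))"
proof -
  have "act (fgen (GT i)) (Y (wlam n k lam \<circ> (v \<circ> adj i))) = Y (wlam n k lam \<circ> v)"
    using act_T_descent[of "wlam n k lam \<circ> (v \<circ> adj i)" i] assms
      grassmannian_comp_young_ascent[OF wlam_in_grassmannian[OF assms(1,3)] assms(2-7)]
    by (simp add: comp_in_Sn wlam_in_Sn comp_adj_in_Sn young_imp_Sn comp_assoc)
  then show ?thesis
    using plen_comp_adj_ascent[OF assms(4,5,7)]
    by (simp add: left.add act_scale act_p scale_right_distrib mult.commute add.commute)
qed

lemma young_eigenvector_Y_lam:
  assumes "lam \<in> parts n k" "k \<le> n"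
  shows "young_eigenvector k (Yl k lam)"
proof (rule young_eigenvectorI[OF assms(2)])
  fix i assume i: "1 \<le> i" "i < n" "i \<noteq> k"
  show "act (Tbar_i i) (Yl k lam) = act (fgen Gp) (Yl k lam)"
    unfolding Y_lam_def
  proof (rule act_Tbar_i_sum_involution[OF i(1,2)])
    fix v assume v: "v \<in> young n k"
    show "v \<circ> adj i \<in> young n k" using v i by (intro comp_adj_in_young)
    show "v \<circ> adj i \<circ> adj i = v" by simp
    show "(v \<circ> adj i) i < (v \<circ> adj i) (Suc i) \<longleftrightarrow> \<not> v i < v (Suc i)"
      using young_imp_Sn[OF v] by (auto elim: Sn_ascent_cases[of _ _ i])
    assume "v i < v (Suc i)"
    from Y_lam_pair[OF assms(1) v assms(2) i this]
    show "\<exists>y. scale (pF ^ plen n (v \<circ> adj i)) (Y (wlam n k lam \<circ> (v \<circ> adj i)))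
      + scale (pF ^ plen n v) (Y (wlam n k lam \<circ> v)) = act (fgen (GT i) + fgen Gp) y" ..
  qed
qed

lemma ev_Tbarw_Y_lam:
  assumes "lam \<in> parts n k" "mu \<in> parts n k" "k \<le> n"
  shows "ev (act (Tbarw n (wlam n k mu)) (Yl k lam)) = (if lam = mu then ev (Y id) else 0)"
proof -
  have "ev (act (Tbarw n (wlam n k mu)) (Yl k lam)) =
      (\<Sum>v\<in>young n k. pF ^ plen n v * ev (act (Tbarw n (wlam n k mu)) (Y (wlam n k lam \<circ> v))))"
    by (simp add: Y_lam_def right.sum act_scale ev.sum ev.scale)
  also have "\<dots> = (\<Sum>v\<in>young n k. if v = id then (if lam = mu then ev (Y id) else 0) else 0)"
  proof (rule sum.cong[OF refl])
    fix v assume v: "v \<in> young n k"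
    have "wlam n k lam \<circ> v = wlam n k mu \<longleftrightarrow> lam = mu \<and> v = id"
      using wlam_factorization_unique[OF assms(1,2) v id_in_young assms(3)] by auto
    moreover have "wlam n k lam \<circ> v \<in> Sn n"
      using v assms by (intro comp_in_Sn wlam_in_Sn young_imp_Sn)
    ultimately show "pF ^ plen n v * ev (act (Tbarw n (wlam n k mu)) (Y (wlam n k lam \<circ> v))) =
      (if v = id then (if lam = mu then ev (Y id) else 0) else 0)"
      using ev_Tbarw_Y[OF wlam_in_Sn[OF assms(2,3)]] by auto
  qed
  also have "\<dots> = (if lam = mu then ev (Y id) else 0)" by simp
  finally show ?thesis .
qed

lemma block_symmetric_times_Y_lam:
  assumes "k \<le> n" "is_Ahx n f" "block_symmetric n k f" "lam \<in> parts n k"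
    and c: "\<And>mu. mu \<in> parts n k \<Longrightarrow> Tbar_expansion n k (wlam n k mu) f (c mu)"
  shows "act (mp_to_fa f) (Yl k lam) =
    (\<Sum>mu\<in>parts n k. scale (mp_eval val (young_character n k (c mu lam))) (Yl k mu))"
proof (rule young_eigenvector_eqI[OF _ _ assms(1)])
  show "young_eigenvector k (act (mp_to_fa f) (Yl k lam))"
    using assms by (intro young_eigenvector_act_block_symmetric young_eigenvector_Y_lam)
  show "young_eigenvector k
      (\<Sum>mu\<in>parts n k. scale (mp_eval val (young_character n k (c mu lam))) (Yl k mu))"
    using assms by (intro young_eigenvector_linear_combination young_eigenvector_Y_lam)
  fix mu assume mu: "mu \<in> parts n k"
  let ?P = "\<lambda>nu. young_character n k (c mu nu)"
  have P: "is_Ahx n (?P nu)" for nu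
    using c[OF mu] by (intro is_Ahx_young_character) (simp add: Tbar_expansion_def)
  have "ev (act (Tbarw n (wlam n k mu)) (act (mp_to_fa f) (Yl k lam)))
    = (\<Sum>nu\<in>parts n k. mp_eval val (?P nu) * ev (act (Tbarw n (wlam n k nu)) (Yl k lam)))"
    using act_Tbar_expansion[OF young_eigenvector_Y_lam[OF assms(4,1)] c[OF mu]]
    by (simp add: ev.sum ev_act_mp_to_fa[OF P])
  also have "\<dots> = mp_eval val (?P lam) * ev (Y id)"
    using assms(1,4) by (simp add: ev_Tbarw_Y_lam if_distrib cong: if_cong)
  also have "\<dots> = ev (act (Tbarw n (wlam n k mu))
      (\<Sum>mu\<in>parts n k. scale (mp_eval val (young_character n k (c mu lam))) (Yl k mu)))"
    using assms(1) mu
    by (simp add: right.sum act_scale ev.sum ev.scale ev_Tbarw_Y_lam if_distrib cong: if_cong)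
  finally show "ev (act (Tbarw n (wlam n k mu)) (act (mp_to_fa f) (Yl k lam))) = \<dots>" .
qed

end

theorem theorem4p5:
  fixes n k :: nat and f :: mpoly
  assumes "k \<le> n" and "is_Ahx n f" and "block_symmetric n k f"
  shows "\<exists>P :: nat list \<Rightarrow> nat list \<Rightarrow> mpoly.
     (\<forall>lam mu. is_Ahx n (P lam mu))
   \<and> (\<forall>mu\<in>parts n k. heq (hrel_loc n k)
         (fmul (Tbar_lam n k mu) (mp_to_fa f))
         (\<Sum>lam\<in>parts n k. fmul (mp_to_fa (P lam mu)) (Tbar_lam n k lam)))
   \<and> (\<forall>(scale :: 'f::field_char_0 \<Rightarrow> 'v::ab_group_add \<Rightarrow> 'v) pF qF hF t Top Xop Y ev.
        schubert_rep n scale pF qF hF t Top Xop Y ev \<longrightarrow>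
        (\<forall>lam\<in>parts n k.
           vact n scale pF qF hF Top Xop (mp_to_fa f) (Y_lam n k scale pF Y lam)
           = (\<Sum>mu\<in>parts n k. scale (mp_eval (eval_val pF qF hF t) (P lam mu)) (Y_lam n k scale pF Y mu))))"
proof -
  have "\<forall>mu\<in>parts n k. \<exists>c. Tbar_expansion n k (wlam n k mu) f c"
    using assms by (simp add: ex_Tbar_expansion wlam_in_Sn)
  then obtain c where c: "\<And>mu. mu \<in> parts n k \<Longrightarrow> Tbar_expansion n k (wlam n k mu) f (c mu)" by metis
  define P where "P lam mu = (if mu \<in> parts n k then young_character n k (c mu lam) else 0)" for lam mu
  show ?thesis
  proof (intro exI[of _ P] conjI allI ballI impI)
    show "is_Ahx n (P lam mu)" for lam mu
      using c by (simp add: P_def is_Ahx_0 is_Ahx_young_character Tbar_expansion_def)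
    show "heq (hrel_loc n k) (fmul (Tbar_lam n k mu) (mp_to_fa f))
      (\<Sum>lam\<in>parts n k. fmul (mp_to_fa (P lam mu)) (Tbar_lam n k lam))" if "mu \<in> parts n k" for mu
      using heq_Tbar_lam_times_block_symmetric[OF assms c] that by (simp add: P_def)
    fix scale :: "'f \<Rightarrow> 'v \<Rightarrow> 'v" and pF qF hF t Top Xop Y ev lam
    assume "schubert_rep n scale pF qF hF t Top Xop Y ev" and lam: "lam \<in> parts n k"
    then interpret S: schubert n scale pF qF hF t Top Xop Y ev by unfold_locales
    show "vact n scale pF qF hF Top Xop (mp_to_fa f) (Y_lam n k scale pF Y lam)
      = (\<Sum>mu\<in>parts n k. scale (mp_eval (eval_val pF qF hF t) (P lam mu)) (Y_lam n k scale pF Y mu))"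
      using S.block_symmetric_times_Y_lam[OF assms lam c] by (simp add: P_def)
  qed
qed

end
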